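(* Let $k\ge1$ and let $\Sigma$ be an infinite real matrix. Then $\Sigma$ is a partially symmetric bounded stationary G-chain (with $2k\times 2k$ blocks) if and only if $\Sigma=T(\widetilde A)$ is generated by some $\widetilde A\in L^\infty_{2k\times 2k}$ such that every matrix in the essential range $\mathcal R(\widetilde A)$ is a G-matrix.
   Context: $L^\infty_{2k\times 2k}$ is the set of measurable functions $\widetilde A$ from $[-\pi,\pi]$ to the complex $2k\times 2k$ matrices with essentially bounded entries and $\widetilde A(-\pi)=\widetilde A(\pi)$. The Fourier coefficients of $\widetilde A$ are $A_n=\frac1{2\pi}\int_{-\pi}^{\pi}\widetilde A(\theta)e^{-\imath n\theta}d\theta$, $n\in\mathbb Z$, and $T(\widetilde A)=[A_{i-j}]_{i,j=0}^\infty$ is the block Toeplitz matrix generated by $\widetilde A$. The essential range $\mathcal R(\widetilde A)$ is the set of all $2k\times2k$ matrices $B$ such that for every $\epsilon>0$ the set $\{t:\|\widetilde A(t)-B\|<\epsilon\}$ has positive Lebesgue measure. $l^2_{2k}$ is the Hilbert space of square summable sequences $(x_0,x_1,\dots)$ with $x_i\in\mathbb C^{2k}$. Let $J_2=\begin{bmatrix}0&1\\-1&0\end{bmatrix}$ and $J_{2m}=J_2\oplus\cdots\oplus J_2$ ($m$ times). A G-matrix is a real positive definite $2m\times 2m$ matrix $B$ with $B+\frac{\imath}{2}J_{2m}\ge0$ (positive semidefinite). A stationary G-chain is an infinite real block Toeplitz matrix $\Sigma=[A_{i-j}]_{i,j=0}^\infty$ with $2k\times 2k$ blocks such that for every $n\in\mathbb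 N$ the truncation $[A_{i-j}]_{i,j=0}^{n-1}$ is a ($2nk\times 2nk$) G-matrix. It is bounded if it is bounded as a linear operator on $l^2_{2k}$, and partially symmetric if every $A_n$ is real and $A_{-n}=A_n$ for all $n\in\mathbb N$. *)

theory Defs
  imports
    "HOL-Analysis.Analysis"
    "Jordan_Normal_Form.Schur_Decomposition"
begin

section \<open>G-matrices\<close>

text \<open>On \<^typ>\<open>complex\<close> the order is that of \<^theory>\<open>HOL-Library.Complex_Order\<close>: a relation
  \<open>0 \<le> z\<close> or \<open>0 < z\<close> includes the assertion that \<open>z\<close> is real.\<close>

definition pos_semidef_mat :: "nat \<Rightarrow> complex mat \<Rightarrow> bool" where
  "pos_semidef_mat d M \<longleftrightarrow> M \<in> carrier_mat d d \<and> mat_adjoint M = M \<and>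
     (\<forall>v \<in> carrier_vec d. 0 \<le> (M *\<^sub>v v) \<bullet>c v)"

definition pos_def_mat :: "nat \<Rightarrow> complex mat \<Rightarrow> bool" where
  "pos_def_mat d M \<longleftrightarrow> M \<in> carrier_mat d d \<and> mat_adjoint M = M \<and>
     (\<forall>v \<in> carrier_vec d. v \<noteq> 0\<^sub>v d \<longrightarrow> 0 < (M *\<^sub>v v) \<bullet>c v)"

definition J2 :: "complex mat" where
  "J2 = mat_of_rows_list 2 [[0, 1], [-1, 0]]"

text \<open>\<open>J_sum m\<close> is the matrix $J_{2m}$, of size \<open>2 * m\<close>.\<close>

definition J_sum :: "nat \<Rightarrow> complex mat" where
  "J_sum m = diag_block_mat (replicate m J2)"

text \<open>A \<open>2 * m\<close> by \<open>2 * m\<close> G-matrix. Real matrices are represented as complex matrices all of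
  whose entries lie in \<open>\<real>\<close>.\<close>

definition G_matrix :: "nat \<Rightarrow> complex mat \<Rightarrow> bool" where
  "G_matrix m B \<longleftrightarrow> B \<in> carrier_mat (2 * m) (2 * m) \<and> elements_mat B \<subseteq> \<real> \<and>
     pos_def_mat (2 * m) B \<and>
     pos_semidef_mat (2 * m) (B + (\<i> / 2) \<cdot>\<^sub>m J_sum m)"


section \<open>Infinite block matrices\<close>

text \<open>An infinite matrix is a function of its scalar row and column index. Its block with block
  indices \<open>i\<close>, \<open>j\<close> occupies the scalar rows \<open>d * i, \<dots>, d * i + d - 1\<close> and the scalar columns
  \<open>d * j, \<dots>, d * j + d - 1\<close>.\<close>

definition block :: "nat \<Rightarrow> (nat \<Rightarrow> nat \<Rightarrow> 'a) \<Rightarrow> nat \<Rightarrow> nat \<Rightarrow> 'a mat" where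
  "block d S i j = mat d d (\<lambda>(a, b). S (d * i + a) (d * j + b))"

definition block_toeplitz :: "nat \<Rightarrow> (int \<Rightarrow> 'a mat) \<Rightarrow> nat \<Rightarrow> nat \<Rightarrow> 'a" where
  "block_toeplitz d A r c = A (int (r div d) - int (c div d)) $$ (r mod d, c mod d)"

definition truncation :: "nat \<Rightarrow> (nat \<Rightarrow> nat \<Rightarrow> 'a) \<Rightarrow> nat \<Rightarrow> 'a mat" where
  "truncation d S n = mat (d * n) (d * n) (\<lambda>(r, c). S r c)"

definition stationary_G_chain :: "nat \<Rightarrow> (nat \<Rightarrow> nat \<Rightarrow> real) \<Rightarrow> bool" where
  "stationary_G_chain k S \<longleftrightarrow>
     (\<exists>A :: int \<Rightarrow> real mat. (\<forall>n. A n \<in> carrier_mat (2 * k) (2 * k)) \<and>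
        S = block_toeplitz (2 * k) A) \<and>
     (\<forall>n \<ge> 1. G_matrix (k * n) (map_mat complex_of_real (truncation (2 * k) S n)))"

definition partially_symmetric :: "nat \<Rightarrow> (nat \<Rightarrow> nat \<Rightarrow> real) \<Rightarrow> bool" where
  "partially_symmetric k S \<longleftrightarrow>
     (\<exists>A :: int \<Rightarrow> real mat. (\<forall>n. A n \<in> carrier_mat (2 * k) (2 * k)) \<and>
        S = block_toeplitz (2 * k) A \<and>
        (\<forall>n :: nat. A (- int n) = A (int n)))"


section \<open>Boundedness on the space of square summable vector sequences\<close>

definition vec_norm2 :: "complex vec \<Rightarrow> real" where
  "vec_norm2 v = L2_set (\<lambda>i. cmod (v $ i)) {..<dim_vec v}"

definition l2_space :: "nat \<Rightarrow> (nat \<Rightarrow> complex vec) set" where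
  "l2_space d = {x. (\<forall>i. x i \<in> carrier_vec d) \<and> summable (\<lambda>i. (vec_norm2 (x i))\<^sup>2)}"

definition l2_norm :: "(nat \<Rightarrow> complex vec) \<Rightarrow> real" where
  "l2_norm x = sqrt (\<Sum>i. (vec_norm2 (x i))\<^sup>2)"

text \<open>The action $(Sx)_i = \sum_j S_{ij} x_j$ of an infinite block matrix; the series of vectors
  is summed componentwise.\<close>

definition block_apply ::
    "nat \<Rightarrow> (nat \<Rightarrow> nat \<Rightarrow> complex) \<Rightarrow> (nat \<Rightarrow> complex vec) \<Rightarrow> nat \<Rightarrow> complex vec" where
  "block_apply d S x i = vec d (\<lambda>a. \<Sum>j. (block d S i j *\<^sub>v x j) $ a)"

definition bounded_on_l2 :: "nat \<Rightarrow> (nat \<Rightarrow> nat \<Rightarrow> complex) \<Rightarrow> bool" where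
  "bounded_on_l2 d S \<longleftrightarrow>
     (\<exists>C. \<forall>x \<in> l2_space d.
        (\<forall>i. \<forall>a < d. summable (\<lambda>j. (block d S i j *\<^sub>v x j) $ a)) \<and>
        block_apply d S x \<in> l2_space d \<and>
        l2_norm (block_apply d S x) \<le> C * l2_norm x)"


section \<open>Matrix-valued symbols\<close>

text \<open>A symbol is a total function on \<^typ>\<open>real\<close>, of which only the restriction to
  \<open>{-pi..pi}\<close> is relevant. Measurability is Lebesgue measurability.\<close>

definition L_inf :: "nat \<Rightarrow> (real \<Rightarrow> complex mat) set" where
  "L_inf d = {F. (\<forall>t \<in> {-pi..pi}. F t \<in> carrier_mat d d) \<and>
     (\<forall>a < d. \<forall>b < d.
        (\<lambda>t. F t $$ (a, b)) \<in> borel_measurable (lebesgue_on {-pi..pi}) \<and>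
        (\<exists>C. AE t in lebesgue_on {-pi..pi}. cmod (F t $$ (a, b)) \<le> C)) \<and>
     F (-pi) = F pi}"

definition fourier_coeff :: "nat \<Rightarrow> (real \<Rightarrow> complex mat) \<Rightarrow> int \<Rightarrow> complex mat" where
  "fourier_coeff d F n = mat d d (\<lambda>(a, b).
     1 / (2 * of_real pi) *
     (LINT t|lebesgue_on {-pi..pi}. F t $$ (a, b) * exp (- \<i> * of_int n * of_real t)))"

definition toeplitz_of_symbol :: "nat \<Rightarrow> (real \<Rightarrow> complex mat) \<Rightarrow> nat \<Rightarrow> nat \<Rightarrow> complex" where
  "toeplitz_of_symbol d F = block_toeplitz d (fourier_coeff d F)"

text \<open>The operator norm. The essential range below does not depend on the choice of the norm.\<close>

definition mat_norm :: "complex mat \<Rightarrow> real" where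
  "mat_norm M = (SUP v \<in> {v \<in> carrier_vec (dim_col M). vec_norm2 v \<le> 1}. vec_norm2 (M *\<^sub>v v))"

definition essential_range :: "nat \<Rightarrow> (real \<Rightarrow> complex mat) \<Rightarrow> complex mat set" where
  "essential_range d F = {B \<in> carrier_mat d d.
     \<forall>\<epsilon> > 0. emeasure lebesgue {t \<in> {-pi..pi}. mat_norm (F t - B) < \<epsilon>} > 0}"

end

theory Submission
  imports Defs
begin

text \<open>The form of a block Toeplitz section at \<open>x\<close> is the mean over the circle of the form of the
  symbol at a trigonometric polynomial with coefficients \<open>x\<close>. So pointwise positivity of
  \<open>F + (\<i> / 2) J\<close> and pointwise bounds on \<open>F\<close> pass to all sections. Conversely, the Fejer means of the
  coefficients are values of the forms of the sections divided by their length, so they inherit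
  positivity and boundedness, and these survive in the limit, which is the symbol. Positive
  definiteness of a real \<open>B\<close> is automatic once \<open>B + (\<i> / 2) J\<close> is positive semidefinite: a null vector of
  \<open>B\<close> is annihilated by both \<open>B + (\<i> / 2) J\<close> and its conjugate, hence by the invertible \<open>J\<close>.
  The symbol takes values in its essential range almost everywhere, and every element of the
  essential range is a limit of values of the symbol taken outside any given null set.\<close>

section \<open>Sesquilinear forms\<close>

text \<open>Most conditions are arranged so that the transfer of positivity carries them too. The
  matrices J of all sizes are sections of one block diagonal matrix, so adding
  \<open>\<i> / 2\<close> times J changes only the coefficient of index 0, that is, adds a constant
  to the symbol. For a bounded Hermitian symbol, boundedness of its Toeplitz matrix T is positivity
  of K + T and K - T for a large constant K. Partial symmetry is a matter of conjugation: with real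
  coefficients it says that the symbol is real. In the direction from chains no symbol is at hand,
  and boundedness has to create it: Parseval turns the uniform bound on the means into square
  summable coefficients, and these give a rate of convergence that is summable along a sparse
  sequence of lengths, common to all entries. For the essential range the obstacle is that the
  operator norm is a supremum over uncountably many vectors; its balls are shown to be measurable by
  covering them with countably many balls of an entrywise distance.\<close>

definition sesq ::
    "nat \<Rightarrow> (nat \<Rightarrow> nat \<Rightarrow> complex) \<Rightarrow> (nat \<Rightarrow> complex) \<Rightarrow> (nat \<Rightarrow> complex) \<Rightarrow> complex" where
  "sesq d M x y = (\<Sum>r<d. \<Sum>c<d. cnj (x r) * M r c * y c)"

text \<open>The order on \<open>complex\<close> makes \<open>0 \<le> z\<close> include that z is
  real, and a complex form with real values is Hermitian, so the adjoint condition of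
  \<open>pos_semidef_mat\<close> is recovered from this in \<open>psd_hermitian\<close>.\<close>

definition psd :: "nat \<Rightarrow> (nat \<Rightarrow> nat \<Rightarrow> complex) \<Rightarrow> bool" where
  "psd d M \<longleftrightarrow> (\<forall>x. 0 \<le> sesq d M x x)"

lemma sesq_cong:
  assumes "\<And>r c. r < d \<Longrightarrow> c < d \<Longrightarrow> M r c = N r c"
    and "\<And>r. r < d \<Longrightarrow> x r = x' r" and "\<And>r. r < d \<Longrightarrow> y r = y' r"
  shows "sesq d M x y = sesq d N x' y'"
  unfolding sesq_def by (intro sum.cong refl) (simp add: assms)

lemma psd_cong:
  assumes "\<And>r c. r < d \<Longrightarrow> c < d \<Longrightarrow> M r c = N r c"
  shows "psd d M \<longleftrightarrow> psd d N"
proof -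
  have "sesq d M x x = sesq d N x x" for x
    by (rule sesq_cong) (simp_all add: assms)
  then show ?thesis by (simp add: psd_def)
qed

lemma sesq_add_right: "sesq d M x (\<lambda>i. y i + z i) = sesq d M x y + sesq d M x z"
  by (simp add: sesq_def algebra_simps sum.distrib)

lemma sesq_add_left: "sesq d M (\<lambda>i. x i + y i) z = sesq d M x z + sesq d M y z"
  by (simp add: sesq_def algebra_simps sum.distrib)

lemma sesq_scale_right: "sesq d M x (\<lambda>i. a * y i) = a * sesq d M x y"
  by (simp add: sesq_def sum_distrib_left mult_ac)

lemma sesq_scale_left: "sesq d M (\<lambda>i. a * x i) y = cnj a * sesq d M x y"
  by (simp add: sesq_def sum_distrib_left mult_ac)

lemma sesq_add_mat: "sesq d (\<lambda>r c. M r c + N r c) x y = sesq d M x y + sesq d N x y"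
  by (simp add: sesq_def algebra_simps sum.distrib)

lemma sesq_scale_mat: "sesq d (\<lambda>r c. a * M r c) x y = a * sesq d M x y"
  by (simp add: sesq_def sum_distrib_left mult_ac)

lemma sesq_cnj_mat: "sesq d (\<lambda>r c. cnj (M r c)) x y = cnj (sesq d M (\<lambda>i. cnj (x i)) (\<lambda>i. cnj (y i)))"
  by (simp add: sesq_def)

lemma sesq_hermitian:
  assumes "\<And>r c. r < d \<Longrightarrow> c < d \<Longrightarrow> N c r = cnj (M r c)"
  shows "sesq d N y x = cnj (sesq d M x y)"
proof -
  have "sesq d N y x = (\<Sum>r<d. \<Sum>c<d. cnj (y r) * cnj (M c r) * x c)"
    unfolding sesq_def by (intro sum.cong refl) (simp add: assms)
  also have "\<dots> = (\<Sum>c<d. \<Sum>r<d. cnj (y r) * cnj (M c r) * x c)"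
    by (rule sum.swap)
  also have "\<dots> = cnj (sesq d M x y)"
    by (simp add: sesq_def mult_ac)
  finally show ?thesis .
qed

lemma sesq_sum_right: "sesq d M x y = (\<Sum>r<d. cnj (x r) * (\<Sum>c<d. M r c * y c))"
  by (simp add: sesq_def sum_distrib_left mult_ac)

lemma sesq_at_two:
  assumes "r < d" "c < d" "r \<noteq> c"
  shows "sesq d M ((\<lambda>_. 0)(r := z, c := w)) ((\<lambda>_. 0)(r := z, c := w)) =
    cnj z * M r r * z + cnj z * M r c * w + cnj w * M c r * z + cnj w * M c c * w"
proof -
  let ?x = "(\<lambda>_. 0)(r := z, c := w)"
  have eq: "(\<Sum>j<d. g j) = g r + g c" if "\<And>j. j \<noteq> r \<Longrightarrow> j \<noteq> c \<Longrightarrow> g j = 0" for g :: "nat \<Rightarrow> complex"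
  proof -
    have "(\<Sum>j<d. g j) = (\<Sum>j\<in>{r, c}. g j)"
      by (rule sum.mono_neutral_right) (use assms that in auto)
    then show ?thesis using assms by simp
  qed
  have inner: "(\<Sum>j<d. M i j * ?x j) = M i r * z + M i c * w" for i
    by (subst eq) (use assms in auto)
  show ?thesis
    unfolding sesq_sum_right inner
    by (subst eq) (use assms in \<open>auto simp: algebra_simps\<close>)
qed

lemma sesq_at_one:
  assumes "r < d"
  shows "sesq d M ((\<lambda>_. 0)(r := 1)) ((\<lambda>_. 0)(r := 1)) = M r r"
proof -
  have "(\<Sum>j<d. M i j * ((\<lambda>_. 0)(r := 1)) j) = M i r" for i
    using assms by (simp add: if_distrib [of "\<lambda>u. M i _ * u"] cong: if_cong)
  then show ?thesis
    using assms by (simp add: sesq_sum_right if_distrib [of "\<lambda>u. u * _"] if_distrib [of cnj] cong: if_cong)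
qed

text \<open>Polarization: the form is real at vectors supported on one or two coordinates.\<close>

lemma psd_hermitian:
  assumes M: "psd d M" and rc: "r < d" "c < d"
  shows "M c r = cnj (M r c)"
proof -
  have diag: "Im (M i i) = 0" if "i < d" for i
    using M that sesq_at_one[of i d M]
    by (metis psd_def less_eq_complex_def zero_complex.sel(2))
  show ?thesis
  proof (cases "r = c")
    case True
    then show ?thesis using diag[OF rc(1)] by (simp add: complex_eq_iff)
  next
    case False
    have "0 = Im (cnj z * M r r * z + cnj z * M r c * w + cnj w * M c r * z + cnj w * M c c * w)" for z w
      using M unfolding psd_def sesq_at_two[OF rc False, symmetric]
      by (simp add: less_eq_complex_def)
    \<comment> \<open>The vector (1, 1) compares the imaginary parts of the two entries, and (1,
      \<i>) compares their real parts.\<close>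
    from this[of 1 1] this[of 1 \<i>] show ?thesis
      using diag[OF rc(1)] diag[OF rc(2)] by (simp add: complex_eq_iff)
  qed
qed

lemma sesq_eq_Re:
  assumes "psd d M" shows "sesq d M x x = of_real (Re (sesq d M x x))" "0 \<le> Re (sesq d M x x)"
  using assms by (auto simp: psd_def less_eq_complex_def complex_eq_iff)

text \<open>A zero of a nonnegative form is a minimum, so the derivative vanishes there in every
  direction. Taking the direction y = M x, the form at y + s x is affine in s with slope
  \<open>2 * Re a\<close>, where a is the squared norm of y; an affine function bounded below has
  slope 0.\<close>

lemma psd_kernel:
  assumes M: "psd d M" and zero: "sesq d M x x = 0" and r: "r < d"
  shows "(\<Sum>c<d. M r c * x c) = 0"
proof -
  define y where "y = (\<lambda>r. \<Sum>c<d. M r c * x c)"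
  define a where "a = sesq d M y x"
  have herm: "sesq d M x y = cnj a"
    unfolding a_def by (rule sesq_hermitian) (rule psd_hermitian[OF M])
  have a: "a = (\<Sum>r<d. of_real ((cmod (y r))\<^sup>2))"
    unfolding a_def sesq_sum_right
    by (intro sum.cong refl) (simp add: y_def complex_norm_square mult.commute del: of_real_power)
  have ge: "0 \<le> Re (sesq d M y y) + s * (2 * Re a)" for s :: real
  proof -
    let ?z = "\<lambda>i. y i + of_real s * x i"
    have "0 \<le> Re (sesq d M ?z ?z)"
      by (rule sesq_eq_Re(2)[OF M])
    also have "sesq d M ?z ?z = sesq d M y y + of_real s * (a + cnj a)"
      by (simp add: sesq_add_left sesq_add_right sesq_scale_left sesq_scale_right zero herm
          algebra_simps flip: a_def)
    finally show ?thesis by simp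
  qed
  have "Re a = 0"
  proof (rule ccontr)
    assume "Re a \<noteq> 0"
    \<comment> \<open>This value of s would make the affine function equal to -1.\<close>
    then have "((- Re (sesq d M y y) - 1) / (2 * Re a)) * (2 * Re a) = - Re (sesq d M y y) - 1"
      by simp
    with ge[of "(- Re (sesq d M y y) - 1) / (2 * Re a)"] show False by simp
  qed
  then have "(\<Sum>r<d. (cmod (y r))\<^sup>2) = 0"
    unfolding a by simp
  then have "\<forall>r\<in>{..<d}. (cmod (y r))\<^sup>2 = 0"
    by (subst (asm) sum_nonneg_eq_0_iff) auto
  then show ?thesis using r by (simp add: y_def)
qed

lemma psd_limit:
  assumes "\<And>n. psd d (M n)"
    and lim: "\<And>r c. r < d \<Longrightarrow> c < d \<Longrightarrow> (\<lambda>n. M n r c) \<longlonglongrightarrow> N r c"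
  shows "psd d N"
  unfolding psd_def
proof
  fix x
  have "(\<lambda>n. sesq d (M n) x x) \<longlonglongrightarrow> sesq d N x x"
    unfolding sesq_def by (intro tendsto_intros lim) auto
  note l = tendsto_Re[OF this] tendsto_Im[OF this]
  have "0 \<le> Re (sesq d N x x)"
    by (rule LIMSEQ_le_const[OF l(1)]) (use assms(1) sesq_eq_Re(2) in blast)
  moreover have "Im (sesq d (M n) x x) = 0" for n
    using assms(1)[of n] by (simp add: psd_def less_eq_complex_def)
  then have "Im (sesq d N x x) = 0"
    using LIMSEQ_unique[OF l(2), of 0] by simp
  ultimately show "0 \<le> sesq d N x x" by (simp add: less_eq_complex_def)
qed

lemma sum_blocks:
  fixes f :: "nat \<Rightarrow> 'a::comm_monoid_add"
  shows "(\<Sum>r<d * n. f r) = (\<Sum>i<n. \<Sum>a<d. f (d * i + a))"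
proof -
  have "(\<Sum>r<d * n. f r) = (\<Sum>i<n. sum f {i * d..<i * d + d})"
    by (simp add: sum.nat_group mult.commute)
  moreover have "sum f {i * d..<i * d + d} = (\<Sum>a<d. f (d * i + a))" for i
    using sum.shift_bounds_nat_ivl[of f 0 "i * d" d]
    by (simp add: atLeast0LessThan add.commute mult.commute)
  ultimately show ?thesis by simp
qed

section \<open>G-matrices in terms of sesquilinear forms\<close>

lemma cscalar_prod_eq_sesq:
  assumes "M \<in> carrier_mat d d" "v \<in> carrier_vec d"
  shows "(M *\<^sub>v v) \<bullet>c v = sesq d (\<lambda>r c. M $$ (r, c)) (\<lambda>i. v $ i) (\<lambda>i. v $ i)"
proof -
  have "(M *\<^sub>v v) \<bullet>c v = (\<Sum>r<d. (\<Sum>c<d. M $$ (r, c) * v $ c) * cnj (v $ r))"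
    using assms unfolding scalar_prod_def
    by (intro sum.cong) (auto simp: scalar_prod_def atLeast0LessThan)
  then show ?thesis by (simp add: sesq_sum_right mult.commute)
qed

lemma mat_adjoint_eq_iff:
  assumes "M \<in> carrier_mat d d"
  shows "mat_adjoint M = M \<longleftrightarrow> (\<forall>r<d. \<forall>c<d. M $$ (c, r) = cnj (M $$ (r, c)))"
proof -
  have carr: "mat_adjoint M \<in> carrier_mat d d"
    using assms by (auto simp: mat_adjoint_def intro!: carrier_matI)
  have ent: "mat_adjoint M $$ (c, r) = cnj (M $$ (r, c))" if "r < d" "c < d" for r c
    using assms that by (simp add: mat_adjoint_def mat_of_rows_def)
  show ?thesis
  proof
    assume "mat_adjoint M = M"
    then show "\<forall>r<d. \<forall>c<d. M $$ (c, r) = cnj (M $$ (r, c))" using ent by metis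
  next
    assume h: "\<forall>r<d. \<forall>c<d. M $$ (c, r) = cnj (M $$ (r, c))"
    have "mat_adjoint M $$ (i, j) = M $$ (i, j)" if "i < d" "j < d" for i j
      using ent[OF that(2,1)] h[rule_format, OF that(2,1)] by (rule trans[OF _ sym])
    then show "mat_adjoint M = M"
      using assms carr by (intro eq_matI) auto
  qed
qed

lemma sesq_vec: "sesq d M (\<lambda>i. vec d x $ i) (\<lambda>i. vec d x $ i) = sesq d M x x"
  by (rule sesq_cong) auto

lemma pos_semidef_mat_iff:
  "pos_semidef_mat d M \<longleftrightarrow> M \<in> carrier_mat d d \<and> psd d (\<lambda>r c. M $$ (r, c))"
proof (cases "M \<in> carrier_mat d d")
  case True
  have "(\<forall>v \<in> carrier_vec d. 0 \<le> (M *\<^sub>v v) \<bullet>c v) \<longleftrightarrow> psd d (\<lambda>r c. M $$ (r, c))"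
  proof
    assume h: "\<forall>v \<in> carrier_vec d. 0 \<le> (M *\<^sub>v v) \<bullet>c v"
    show "psd d (\<lambda>r c. M $$ (r, c))"
      unfolding psd_def
    proof
      fix x :: "nat \<Rightarrow> complex"
      show "0 \<le> sesq d (\<lambda>r c. M $$ (r, c)) x x"
        using h[rule_format, of "vec d x"] unfolding cscalar_prod_eq_sesq[OF True vec_carrier] sesq_vec
        by simp
    qed
  next
    assume "psd d (\<lambda>r c. M $$ (r, c))"
    then show "\<forall>v \<in> carrier_vec d. 0 \<le> (M *\<^sub>v v) \<bullet>c v"
      by (simp add: psd_def cscalar_prod_eq_sesq[OF True])
  qed
  moreover have "mat_adjoint M = M" if "psd d (\<lambda>r c. M $$ (r, c))"
    unfolding mat_adjoint_eq_iff[OF True] by (blast intro: psd_hermitian[OF that])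
  ultimately show ?thesis
    using True by (auto simp: pos_semidef_mat_def)
qed (simp add: pos_semidef_mat_def)

text \<open>One infinite matrix whose leading sections are the \<open>J_sum m\<close>, so that
  truncations of all lengths share the same J.\<close>

definition J_entry :: "nat \<Rightarrow> nat \<Rightarrow> complex" where
  "J_entry r c = (if even r \<and> c = Suc r then 1 else if even c \<and> r = Suc c then -1 else 0)"

lemma J_entry_antisym: "J_entry c r = - J_entry r c"
  by (auto simp: J_entry_def)

lemma cnj_J_entry [simp]: "cnj (J_entry r c) = J_entry r c"
  by (simp add: J_entry_def)

lemma dim_J_sum: "dim_row (J_sum m) = 2 * m" "dim_col (J_sum m) = 2 * m"
  by (simp_all add: J_sum_def dim_diag_block_mat J2_def mat_of_rows_list_def sum_list_replicate)

lemma J_sum_entry: "r < 2 * m \<Longrightarrow> c < 2 * m \<Longrightarrow> J_sum m $$ (r, c) = J_entry r c"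
proof (induction m arbitrary: r c)
  case (Suc m)
  have "J_sum (Suc m) = four_block_mat J2 (0\<^sub>m 2 (2 * m)) (0\<^sub>m (2 * m) 2) (J_sum m)"
  proof -
    have "J_sum (Suc m) = four_block_mat J2 (0\<^sub>m (dim_row J2) (dim_col (J_sum m)))
        (0\<^sub>m (dim_row (J_sum m)) (dim_col J2)) (J_sum m)"
      by (simp add: J_sum_def Let_def)
    moreover have "dim_row J2 = 2" "dim_col J2 = 2"
      by (simp_all add: J2_def mat_of_rows_list_def)
    ultimately show ?thesis by (simp only: dim_J_sum)
  qed
  then have "J_sum (Suc m) $$ (r, c) =
     (if r < 2 then if c < 2 then J2 $$ (r, c) else 0 else if c < 2 then 0 else J_sum m $$ (r - 2, c - 2))"
    using Suc.prems dim_J_sum[of m] by (simp add: J2_def mat_of_rows_list_def numeral_2_eq_2)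
  also have "\<dots> = J_entry r c"
  proof (cases "r < 2"; cases "c < 2")
    assume "r < 2" "c < 2"
    then have "r \<in> {0, 1}" "c \<in> {0, 1}" by auto
    then show ?thesis by (auto simp: J_entry_def J2_def mat_of_rows_list_def)
  next
    assume "\<not> r < 2" "\<not> c < 2"
    then obtain r' c' where "r = Suc (Suc r')" "c = Suc (Suc c')"
      by (metis add_2_eq_Suc le_add_diff_inverse not_less)
    then show ?thesis using Suc by (simp add: J_entry_def)
  qed (auto simp: J_entry_def)
  finally show ?case .
qed simp

text \<open>J couples only the indices 2p and 2p + 1, and blocks have even size, so no coupled pair
  straddles a block boundary. Hence the infinite J is block diagonal with equal blocks, that is,
  block Toeplitz with a single nonzero coefficient.\<close>

lemma J_entry_block:
  assumes "a < 2 * k" "b < 2 * k"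
  shows "J_entry (2 * k * i + a) (2 * k * j + b) = (if i = j then J_entry a b else 0)"
proof (cases "i = j")
  case False
  have *: "2 * k * j + b \<noteq> Suc (2 * k * i + a)"
    if "i \<noteq> j" "a < 2 * k" "b < 2 * k" "even a" for i j a b
  proof
    assume eq: "2 * k * j + b = Suc (2 * k * i + a)"
    have "Suc a < 2 * k" using that(2,4) by presburger
    then have "(2 * k * j + b) div (2 * k) = j" "(2 * k * i + Suc a) div (2 * k) = i"
      using that by (simp_all del: add_Suc_right)
    with eq that(1) show False by (metis add_Suc_right)
  qed
  show ?thesis
    using False *[OF False assms] *[of j i b a] assms by (auto simp: J_entry_def)
qed (simp add: J_entry_def)

text \<open>Conjugating entries preserves positivity and, since B and J are real, only changes the
  sign of the J term. So B is the mean of the positive matrices \<open>Q\<close> and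
  \<open>Q'\<close>, and a zero of the form of B is a zero of both of theirs.\<close>

lemma G_matrix_iff:
  "G_matrix m B \<longleftrightarrow> B \<in> carrier_mat (2 * m) (2 * m) \<and>
     (\<forall>r<2 * m. \<forall>c<2 * m. B $$ (r, c) \<in> \<real>) \<and>
     psd (2 * m) (\<lambda>r c. B $$ (r, c) + \<i> / 2 * J_entry r c)"
proof (cases "B \<in> carrier_mat (2 * m) (2 * m)")
  case B: True
  define Q where "Q = (\<lambda>r c. B $$ (r, c) + \<i> / 2 * J_entry r c)"
  have carr: "B + (\<i> / 2) \<cdot>\<^sub>m J_sum m \<in> carrier_mat (2 * m) (2 * m)"
    using dim_J_sum by (intro carrier_matI) auto
  have "psd (2 * m) (\<lambda>r c. (B + (\<i> / 2) \<cdot>\<^sub>m J_sum m) $$ (r, c)) \<longleftrightarrow> psd (2 * m) Q"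
    by (rule psd_cong) (use B dim_J_sum[of m] in \<open>auto simp: J_sum_entry Q_def\<close>)
  then have 1: "pos_semidef_mat (2 * m) (B + (\<i> / 2) \<cdot>\<^sub>m J_sum m) \<longleftrightarrow> psd (2 * m) Q"
    using carr by (simp add: pos_semidef_mat_iff)
  have 2: "elements_mat B \<subseteq> \<real> \<longleftrightarrow> (\<forall>r<2 * m. \<forall>c<2 * m. B $$ (r, c) \<in> \<real>)"
    using B unfolding elements_mat_def by (auto simp: UN_subset_iff image_subset_iff)
  have "pos_def_mat (2 * m) B"
    if Q: "psd (2 * m) Q" and real: "\<forall>r<2 * m. \<forall>c<2 * m. B $$ (r, c) \<in> \<real>"
  proof -
    have re: "cnj (B $$ (r, c)) = B $$ (r, c)" if "r < 2 * m" "c < 2 * m" for r c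
      using real that by (simp add: Reals_cnj_iff)
    define Q' where "Q' = (\<lambda>r c. cnj (Q r c))"
    have psd': "psd (2 * m) Q'"
      unfolding psd_def Q'_def sesq_cnj_mat
      using sesq_eq_Re[OF Q] by (simp add: less_eq_complex_def complex_eq_iff)
    have Q'_eq: "Q' r c = B $$ (r, c) - \<i> / 2 * J_entry r c" if "r < 2 * m" "c < 2 * m" for r c
      using that by (simp add: Q'_def Q_def re)
    have split: "sesq (2 * m) (\<lambda>r c. B $$ (r, c)) x x = (sesq (2 * m) Q x x + sesq (2 * m) Q' x x) / 2" for x
    proof -
      have "sesq (2 * m) Q x x + sesq (2 * m) Q' x x = sesq (2 * m) (\<lambda>r c. 2 * B $$ (r, c)) x x"
        unfolding sesq_add_mat[symmetric] by (rule sesq_cong) (simp_all add: Q_def Q'_eq)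
      then show ?thesis by (simp add: sesq_scale_mat)
    qed
    have "B $$ (c, r) = cnj (B $$ (r, c))" if "r < 2 * m" "c < 2 * m" for r c
      using psd_hermitian[OF Q that] J_entry_antisym[of c r] by (simp add: Q_def)
    then have "mat_adjoint B = B"
      unfolding mat_adjoint_eq_iff[OF B] by blast
    moreover have "0 < (B *\<^sub>v v) \<bullet>c v" if v: "v \<in> carrier_vec (2 * m)" "v \<noteq> 0\<^sub>v (2 * m)" for v
    proof -
      let ?x = "\<lambda>i. v $ i"
      have "(B *\<^sub>v v) \<bullet>c v \<noteq> 0"
      proof
        assume "(B *\<^sub>v v) \<bullet>c v = 0"
        then have "sesq (2 * m) Q ?x ?x + sesq (2 * m) Q' ?x ?x = 0"
          by (simp add: cscalar_prod_eq_sesq[OF B v(1)] split)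
        then have z: "sesq (2 * m) Q ?x ?x = 0" "sesq (2 * m) Q' ?x ?x = 0"
          using sesq_eq_Re[OF Q, of ?x] sesq_eq_Re[OF psd', of ?x]
          by (auto simp: complex_eq_iff)
        have J0: "(\<Sum>c<2 * m. J_entry r c * v $ c) = 0" if "r < 2 * m" for r
        proof -
          have "(\<Sum>c<2 * m. Q r c * v $ c) - (\<Sum>c<2 * m. Q' r c * v $ c)
              = (\<Sum>c<2 * m. \<i> * (J_entry r c * v $ c))"
            unfolding sum_subtractf[symmetric]
            by (intro sum.cong) (use that in \<open>auto simp: Q_def Q'_eq algebra_simps\<close>)
          then show ?thesis
            using psd_kernel[OF Q z(1) that] psd_kernel[OF psd' z(2) that]
            by (simp flip: sum_distrib_left)
        qed
        \<comment> \<open>The row of J belonging to the partner of c (c + 1 for even c, c - 1 for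
          odd c) has its only nonzero entry in column c.\<close>
        have "v $ c = 0" if c: "c < 2 * m" for c
        proof (cases "even c")
          case True
          then have "Suc c < 2 * m" using c by presburger
          moreover have "J_entry (Suc c) c' * v $ c' = (if c' = c then - v $ c else 0)" for c'
            using True by (auto simp: J_entry_def)
          ultimately show ?thesis
            using J0[of "Suc c"] c by simp
        next
          case False
          then obtain e where e: "c = Suc e" "even e" by (metis oddE even_mult_iff even_two_times_div_two Suc_eq_plus1 dvd_triv_left)
          have "J_entry e c' * v $ c' = (if c' = c then v $ c else 0)" for c'
            using e by (auto simp: J_entry_def)
          then show ?thesis
            using J0[of e] c e by simp
        qed
        then have "v = 0\<^sub>v (2 * m)" using v(1) by (intro eq_vecI) auto
        with v(2) show False by simp
      qed
      moreover have "0 \<le> (B *\<^sub>v v) \<bullet>c v"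
        using sesq_eq_Re[OF Q, of ?x] sesq_eq_Re[OF psd', of ?x]
        by (simp add: cscalar_prod_eq_sesq[OF B v(1)] split less_eq_complex_def complex_eq_iff)
      ultimately show ?thesis by simp
    qed
    ultimately show ?thesis using B by (simp add: pos_def_mat_def)
  qed
  then show ?thesis
    using B 1 2 by (auto simp: G_matrix_def Q_def)
qed (simp add: G_matrix_def)

section \<open>Block Toeplitz sections of a symbol\<close>

abbreviation circ :: "real measure" where
  "circ \<equiv> lebesgue_on {-pi..pi}"

lemma emeasure_circ: "emeasure circ (space circ) = ennreal (2 * pi)"
  by (simp add: emeasure_restrict_space space_restrict_space)

lemma finite_measure_circ: "finite_measure circ"
  by (rule finite_measureI) (unfold emeasure_circ, simp)

text \<open>The counterpart of \<open>block_toeplitz\<close> for coefficients given entrywise, where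
  adding constants and scaling involve no dimension conditions.\<close>

definition toep :: "nat \<Rightarrow> (int \<Rightarrow> nat \<Rightarrow> nat \<Rightarrow> complex) \<Rightarrow> nat \<Rightarrow> nat \<Rightarrow> complex" where
  "toep d A r c = A (int (r div d) - int (c div d)) (r mod d) (c mod d)"

lemma toep_block:
  assumes "a < d" "b < d"
  shows "toep d A (d * i + a) (d * j + b) = A (int i - int j) a b"
  using assms by (simp add: toep_def)

lemma sesq_toep:
  "sesq (d * n) (toep d A) x y =
    (\<Sum>i<n. \<Sum>a<d. \<Sum>j<n. \<Sum>b<d. cnj (x (d * i + a)) * A (int i - int j) a b * y (d * j + b))"
  unfolding sesq_def sum_blocks
  by (intro sum.cong refl) (simp add: toep_block)

definition fcoef :: "(real \<Rightarrow> nat \<Rightarrow> nat \<Rightarrow> complex) \<Rightarrow> int \<Rightarrow> nat \<Rightarrow> nat \<Rightarrow> complex" where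
  "fcoef G m a b = 1 / (2 * of_real pi) * (LINT t|circ. G t a b * cis (- (of_int m * t)))"

lemma fourier_coeff_entry:
  assumes "a < d" "b < d"
  shows "fourier_coeff d F m $$ (a, b) = fcoef (\<lambda>t a b. F t $$ (a, b)) m a b"
  using assms by (simp add: fourier_coeff_def fcoef_def cis_conv_exp mult_ac)

lemma toeplitz_of_symbol_eq_toep:
  assumes "0 < d"
  shows "toeplitz_of_symbol d F = toep d (fcoef (\<lambda>t a b. F t $$ (a, b)))"
  using assms by (simp add: toeplitz_of_symbol_def block_toeplitz_def toep_def fun_eq_iff fourier_coeff_entry)

lemma measurable_cis [measurable]: "(\<lambda>t. cis (c * t)) \<in> borel_measurable circ"
proof -
  have "(\<lambda>t. cis (c * t)) \<in> borel_measurable borel"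
    by (intro borel_measurable_continuous_onI continuous_intros)
  then have "(\<lambda>t. cis (c * t)) \<in> borel_measurable lebesgue"
    by (intro measurable_completion) simp
  then show ?thesis by (rule measurable_restrict_space1)
qed

lemma integrable_mult_cis:
  assumes "integrable circ f"
  shows "integrable circ (\<lambda>t. f t * cis (c * t))"
proof (rule Bochner_Integration.integrable_bound[OF assms])
  show "(\<lambda>t. f t * cis (c * t)) \<in> borel_measurable circ"
    using borel_measurable_integrable[OF assms] by measurable
qed (simp add: norm_mult)

lemma complex_integral_nonneg:
  assumes "integrable M f" "AE t in M. 0 \<le> (f t :: complex)"
  shows "0 \<le> (LINT t|M. f t)"
proof -
  have "0 \<le> (LINT t|M. Re (f t))"
    by (rule integral_nonneg_AE) (use assms(2) in \<open>auto simp: less_eq_complex_def\<close>)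
  moreover have "(LINT t|M. Im (f t)) = (LINT t|M. 0)"
    by (rule integral_cong_AE)
      (use assms borel_measurable_integrable in \<open>auto simp: less_eq_complex_def\<close>)
  ultimately show ?thesis
    using assms(1) by (simp add: less_eq_complex_def)
qed

text \<open>With the trigonometric vector polynomial \<open>p t a = (\<Sum>i<n. x (d * i + a) * cis (i * t))\<close>,
  the form of the Toeplitz section at \<open>x\<close> is the mean over the circle of the form of the symbol at
  \<open>p t\<close>.\<close>

lemma psd_toep_fcoef:
  assumes int: "\<And>a b. a < d \<Longrightarrow> b < d \<Longrightarrow> integrable circ (\<lambda>t. G t a b)"
    and psd: "AE t in circ. psd d (G t)"
  shows "psd (d * n) (toep d (fcoef G))"
  unfolding psd_def
proof
  fix x :: "nat \<Rightarrow> complex"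
  define p where "p t a = (\<Sum>i<n. x (d * i + a) * cis (of_nat i * t))" for t a
  define g where "g t i a j b = cnj (x (d * i + a)) * (G t a b * cis (- (of_int (int i - int j) * t)))
    * x (d * j + b)" for t i a j b
  \<comment> \<open>The phase depends on the difference of the indices only, with the sign of the
    kernel of the coefficient of index i - j; conjugation in the first argument of
    \<open>sesq\<close> produces it.\<close>
  have cis: "cnj (cis (of_nat i * t)) * cis (of_nat j * t) = cis (- (of_int (int i - int j) * t))"
    for i j :: nat and t :: real
    by (simp add: cis_cnj cis_mult left_diff_distrib)
  have form: "sesq d (G t) (p t) (p t) = (\<Sum>i<n. \<Sum>a<d. \<Sum>j<n. \<Sum>b<d. g t i a j b)" for t
  proof -
    have "sesq d (G t) (p t) (p t) = (\<Sum>a<d. \<Sum>b<d. \<Sum>i<n. \<Sum>j<n. g t i a j b)"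
      unfolding sesq_def
    proof (intro sum.cong refl)
      fix a b
      have "cnj (p t a) * G t a b * p t b = G t a b * (cnj (p t a) * p t b)"
        by simp
      also have "\<dots> = (\<Sum>i<n. \<Sum>j<n. G t a b *
          (cnj (x (d * i + a) * cis (of_nat i * t)) * (x (d * j + b) * cis (of_nat j * t))))"
        unfolding p_def cnj_sum sum_product by (simp only: sum_distrib_left)
      also have "\<dots> = (\<Sum>i<n. \<Sum>j<n. g t i a j b)"
        unfolding g_def cis[symmetric] by (simp add: mult_ac)
      finally show "cnj (p t a) * G t a b * p t b = (\<Sum>i<n. \<Sum>j<n. g t i a j b)" .
    qed
    also have "\<dots> = (\<Sum>a<d. \<Sum>i<n. \<Sum>j<n. \<Sum>b<d. g t i a j b)"
    proof (rule sum.cong[OF refl])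
      fix a
      show "(\<Sum>b<d. \<Sum>i<n. \<Sum>j<n. g t i a j b) = (\<Sum>i<n. \<Sum>j<n. \<Sum>b<d. g t i a j b)"
        by (subst sum.swap) (intro sum.cong refl sum.swap)
    qed
    also have "\<dots> = (\<Sum>i<n. \<Sum>a<d. \<Sum>j<n. \<Sum>b<d. g t i a j b)"
      by (rule sum.swap)
    finally show ?thesis .
  qed
  have intg: "integrable circ (\<lambda>t. g t i a j b)" if "a < d" "b < d" for i a j b
    unfolding g_def using integrable_mult_cis[OF int[OF that], of "- of_int (int i - int j)"]
    by (intro integrable_mult_right integrable_mult_left) (simp only: mult_minus_left)
  have "0 \<le> (LINT t|circ. sesq d (G t) (p t) (p t))"
  proof (rule complex_integral_nonneg)
    show "integrable circ (\<lambda>t. sesq d (G t) (p t) (p t))"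
      unfolding form by (intro Bochner_Integration.integrable_sum intg) auto
    show "AE t in circ. 0 \<le> sesq d (G t) (p t) (p t)"
      using psd by eventually_elim (simp add: psd_def)
  qed
  also have "(LINT t|circ. sesq d (G t) (p t) (p t)) =
      (\<Sum>i<n. \<Sum>a<d. \<Sum>j<n. \<Sum>b<d. LINT t|circ. g t i a j b)"
    unfolding form
    by (intro has_bochner_integral_integral_eq has_bochner_integral_sum has_bochner_integral_integrable intg)
      auto
  also have "\<dots> = (\<Sum>i<n. \<Sum>a<d. \<Sum>j<n. \<Sum>b<d. (2 * of_real pi) *
      (cnj (x (d * i + a)) * fcoef G (int i - int j) a b * x (d * j + b)))"
    by (intro sum.cong refl) (simp add: g_def fcoef_def)
  also have "\<dots> = of_real (2 * pi) * sesq (d * n) (toep d (fcoef G)) x x"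
    unfolding sesq_toep by (simp add: sum_distrib_left)
  finally show "0 \<le> sesq (d * n) (toep d (fcoef G)) x x"
    using pi_gt_zero by (auto simp: less_eq_complex_def zero_le_mult_iff)
qed

lemma integral_cis:
  "(LINT t|circ. cis (of_int m * t)) = (if m = 0 then 2 * of_real pi else 0)"
proof (cases "m = 0")
  case True
  then show ?thesis by (simp add: measure_restrict_space scaleR_conv_of_real)
next
  case False
  let ?f = "\<lambda>z. exp (\<i> * of_int m * z) / (\<i> * of_int m)"
  have deriv: "((\<lambda>t. ?f (of_real t)) has_vector_derivative cis (of_int m * t)) (at t within {-pi..pi})" for t :: real
  proof (rule has_vector_derivative_real_field)
    show "(?f has_field_derivative cis (of_int m * t)) (at (of_real t))"
      using False by (auto intro!: derivative_eq_intros simp: cis_conv_exp mult_ac)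
  qed
  have "((\<lambda>t. cis (of_int m * t)) has_integral (?f (of_real pi) - ?f (of_real (-pi)))) {-pi..pi}"
    by (rule fundamental_theorem_of_calculus) (use deriv in auto)
  moreover have "?f (of_real pi) = ?f (of_real (-pi))"
  proof -
    have "cis (of_int m * pi) = cis (of_int m * (-pi))"
      by (simp add: complex_eq_iff mult.commute)
    then show ?thesis by (simp add: cis_conv_exp mult_ac)
  qed
  ultimately have "((\<lambda>t. cis (of_int m * t)) has_integral 0) {-pi..pi}"
    by simp
  moreover have "integrable circ (\<lambda>t. cis (of_int m * t))"
    using continuous_imp_integrable_real[of "-pi" pi "\<lambda>t. cis (of_int m * t)"]
    by (simp add: continuous_intros)
  ultimately show ?thesis
    using False by (simp add: lebesgue_integral_eq_integral integral_unique)
qed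

section \<open>Bounded operators and finite sections\<close>

text \<open>A uniform operator bound for the square sections cut at block boundaries. Only the
  square of \<open>K\<close> enters, so its sign is free; this is why \<open>\<bar>K\<bar>\<close>
  appears in the consequences.\<close>

definition section_bound :: "nat \<Rightarrow> (nat \<Rightarrow> nat \<Rightarrow> complex) \<Rightarrow> real \<Rightarrow> bool" where
  "section_bound d S K \<longleftrightarrow> (\<forall>n x.
     (\<Sum>r<d * n. (cmod (\<Sum>c<d * n. S r c * x c))\<^sup>2) \<le> K\<^sup>2 * (\<Sum>c<d * n. (cmod (x c))\<^sup>2))"

lemma sesq_diag:
  "sesq N (\<lambda>r c. if r = c then a else 0) x x = a * of_real (\<Sum>c<N. (cmod (x c))\<^sup>2)"
proof -
  have "(\<Sum>c<N. (if r = c then a else 0) * x c) = a * x r" if "r < N" for r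
    using that by (simp add: if_distrib[of "\<lambda>u. u * _"] cong: if_cong)
  then show ?thesis
    unfolding sesq_sum_right
    by (simp add: sum_distrib_left complex_norm_square mult_ac del: of_real_power)
qed

text \<open>The operator norm of a Hermitian matrix is the largest absolute value of its form on
  unit vectors. With y = S x, the forms at x + e y and x - e y differ by 4 e times the squared norm
  of y, and the parallelogram law bounds this difference through the norms of x and y.\<close>

lemma section_bound_if_psd:
  assumes K: "0 < K"
    and minus: "\<And>n. psd (d * n) (\<lambda>r c. (if r = c then of_real K else 0) - S r c)"
    and plus: "\<And>n. psd (d * n) (\<lambda>r c. (if r = c then of_real K else 0) + S r c)"
  shows "section_bound d S K"
  unfolding section_bound_def
proof (intro allI)
  fix n and x :: "nat \<Rightarrow> complex"
  define N where "N = d * n"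
  define q where "q z = Re (sesq N S z z)" for z
  define nn where "nn z = (\<Sum>c<N. (cmod (z c))\<^sup>2)" for z :: "nat \<Rightarrow> complex"
  define y where "y r = (\<Sum>c<N. S r c * x c)" for r
  \<comment> \<open>The resulting inequality bounds (4 e - 2 K e^2) times the squared norm of y by 2
    K times that of x; e = 1 / K maximizes the factor and gives the constant
    \<open>K\<^sup>2\<close> exactly.\<close>
  define u where "u = (\<lambda>i. x i + of_real (1 / K) * y i)"
  define v where "v = (\<lambda>i. x i + of_real (- 1 / K) * y i)"
  have herm: "S c r = cnj (S r c)" if "r < N" "c < N" for r c
    using psd_hermitian[OF minus[of n] that[unfolded N_def]] by (auto split: if_splits)
  have upper: "q z \<le> K * nn z" for z
  proof -
    have "0 \<le> Re (sesq N (\<lambda>r c. (if r = c then of_real K else 0) + (- 1) * S r c) z z)"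
      using sesq_eq_Re(2)[OF minus[of n], of z] by (simp add: N_def)
    then show ?thesis
      unfolding sesq_add_mat sesq_scale_mat sesq_diag by (simp add: q_def nn_def)
  qed
  have lower: "- q z \<le> K * nn z" for z
    using sesq_eq_Re(2)[OF plus[of n], of z]
    unfolding N_def[symmetric] sesq_add_mat sesq_diag by (simp add: q_def nn_def)
  have yx: "sesq N S y x = of_real (nn y)"
    unfolding sesq_sum_right nn_def y_def[symmetric]
    by (simp add: complex_norm_square mult.commute del: of_real_power)
  have xy: "sesq N S x y = of_real (nn y)"
    using sesq_hermitian[of N S S x y] herm yx by (metis complex_cnj_complex_of_real)
  have par: "nn u + nn v = 2 * nn x + 2 * nn y / K\<^sup>2"
  proof -
    have "(cmod (u c))\<^sup>2 + (cmod (v c))\<^sup>2 = 2 * (cmod (x c))\<^sup>2 + 2 / K\<^sup>2 * (cmod (y c))\<^sup>2" for c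
    proof -
      have par: "(cmod (a + b))\<^sup>2 + (cmod (a - b))\<^sup>2 = 2 * (cmod a)\<^sup>2 + 2 * (cmod b)\<^sup>2" for a b
        unfolding cmod_power2 by (simp add: power2_eq_square algebra_simps)
      have "(cmod (of_real (1 / K) * y c))\<^sup>2 = 1 / K\<^sup>2 * (cmod (y c))\<^sup>2"
        using K by (simp add: norm_mult norm_divide power_mult_distrib power_divide)
      then show ?thesis
        using par[of "x c" "of_real (1 / K) * y c"] by (simp add: u_def v_def)
    qed
    then have "nn u + nn v = (\<Sum>c<N. 2 * (cmod (x c))\<^sup>2 + 2 / K\<^sup>2 * (cmod (y c))\<^sup>2)"
      unfolding nn_def sum.distrib[symmetric] by simp
    then show ?thesis
      by (simp add: nn_def sum.distrib sum_distrib_left sum_divide_distrib)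
  qed
  have "q (\<lambda>i. x i + of_real e * y i) = q x + 2 * e * nn y + e\<^sup>2 * q y" for e
    unfolding q_def sesq_add_left sesq_add_right sesq_scale_left sesq_scale_right xy yx
    by (simp add: algebra_simps power2_eq_square)
  note this[of "1 / K"] this[of "- 1 / K"]
  then have "q u - q v = 4 / K * nn y"
    by (simp add: u_def v_def)
  moreover have "q u - q v \<le> K * (nn u + nn v)"
    using upper[of u] lower[of v] by (simp add: distrib_left)
  ultimately have "4 / K * nn y \<le> K * (2 * nn x + 2 * nn y / K\<^sup>2)"
    by (simp add: par)
  also have "\<dots> = 2 * K * nn x + 2 / K * nn y"
    using K by (simp add: field_simps power2_eq_square)
  finally have "nn y \<le> K\<^sup>2 * nn x"
    using K by (simp add: field_simps power2_eq_square)
  then show "(\<Sum>r<d * n. (cmod (\<Sum>c<d * n. S r c * x c))\<^sup>2) \<le> K\<^sup>2 * (\<Sum>c<d * n. (cmod (x c))\<^sup>2)"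
    by (simp add: nn_def y_def N_def)
qed

lemma vec_norm2_power2: "(vec_norm2 v)\<^sup>2 = (\<Sum>i<dim_vec v. (cmod (v $ i))\<^sup>2)"
  by (simp add: vec_norm2_def L2_set_def sum_nonneg)

lemma block_mult_entry:
  assumes "a < d" "v \<in> carrier_vec d"
  shows "(block d S i j *\<^sub>v v) $ a = (\<Sum>b<d. S (d * i + a) (d * j + b) * v $ b)"
  using assms by (simp add: block_def scalar_prod_def atLeast0LessThan)

text \<open>Rotating the phases of x makes every term of row r nonnegative, so the bound on the
  section controls the absolute sum. This yields absolute convergence of the series in
  \<open>block_apply\<close>.\<close>

lemma section_bound_abs_row:
  assumes S: "section_bound d S K" and d: "0 < d"
  shows "(\<Sum>c<d * n. cmod (S r c) * cmod (x c)) \<le> \<bar>K\<bar> * sqrt (\<Sum>c<d * (n + Suc r). (cmod (x c))\<^sup>2)"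
proof -
  \<comment> \<open>The square section has to contain row r itself; since d > 0, r + 1 further
    blocks suffice.\<close>
  define m where "m = n + Suc r"
  define w where "w c = of_real (cmod (x c)) * cnj (sgn (S r c))" for c
  have r: "r < d * m"
    using d by (cases d) (simp_all add: m_def)
  have sgn: "z * cnj (sgn z) = of_real (cmod z)" for z :: complex
  proof (cases "z = 0")
    case False
    have "z * cnj (sgn z) = (z * cnj z) / of_real (cmod z)"
      by (simp add: sgn_eq)
    then show ?thesis
      using False by (simp add: complex_norm_square[symmetric] power2_eq_square)
  qed simp
  have eq: "(\<Sum>c<d * m. S r c * w c) = of_real (\<Sum>c<d * m. cmod (S r c) * cmod (x c))"
  proof -
    have "S r c * w c = of_real (cmod (S r c) * cmod (x c))" for c
      using sgn[of "S r c"] unfolding w_def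
      by (metis mult.left_commute mult.commute of_real_mult)
    then show ?thesis by simp
  qed
  have "(\<Sum>c<d * n. cmod (S r c) * cmod (x c)) \<le> (\<Sum>c<d * m. cmod (S r c) * cmod (x c))"
    by (rule sum_mono2) (auto simp: m_def algebra_simps)
  moreover have "(\<Sum>c<d * m. cmod (S r c) * cmod (x c))\<^sup>2 \<le> K\<^sup>2 * (\<Sum>c<d * m. (cmod (x c))\<^sup>2)"
  proof -
    have "(\<Sum>c<d * m. cmod (S r c) * cmod (x c))\<^sup>2 = (cmod (\<Sum>c<d * m. S r c * w c))\<^sup>2"
      by (simp add: eq del: of_real_sum)
    also have "\<dots> \<le> (\<Sum>r<d * m. (cmod (\<Sum>c<d * m. S r c * w c))\<^sup>2)"
      using r by (intro member_le_sum) auto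
    also have "\<dots> \<le> K\<^sup>2 * (\<Sum>c<d * m. (cmod (w c))\<^sup>2)"
      using S by (simp add: section_bound_def)
    also have "\<dots> \<le> K\<^sup>2 * (\<Sum>c<d * m. (cmod (x c))\<^sup>2)"
      by (intro mult_left_mono sum_mono) (auto simp: w_def norm_mult norm_sgn)
    finally show ?thesis .
  qed
  then have "\<bar>\<Sum>c<d * m. cmod (S r c) * cmod (x c)\<bar> \<le> sqrt (K\<^sup>2 * (\<Sum>c<d * m. (cmod (x c))\<^sup>2))"
    by (rule real_le_rsqrt[of "\<bar>_\<bar>", simplified])
  ultimately show ?thesis
    by (simp add: real_sqrt_mult m_def)
qed

text \<open>Two limits in a fixed order: the rows are first restricted to m blocks while the columns
  grow, each such rectangle lying in a square section once n is at least m; afterwards m grows. Only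
  convergence of each single row is needed for the inner limit.\<close>

lemma section_bound_imp_bounded_on_l2:
  assumes S: "section_bound d S K" and d: "0 < d"
  shows "bounded_on_l2 d S"
  unfolding bounded_on_l2_def
proof (intro exI ballI)
  fix x assume x: "x \<in> l2_space d"
  have carr: "x j \<in> carrier_vec d" for j
    using x by (simp add: l2_space_def)
  have sx: "summable (\<lambda>i. (vec_norm2 (x i))\<^sup>2)"
    using x by (simp add: l2_space_def)
  define X where "X = (\<Sum>i. (vec_norm2 (x i))\<^sup>2)"
  define \<xi> where "\<xi> c = x (c div d) $ (c mod d)" for c
  have \<xi>: "\<xi> (d * j + b) = x j $ b" if "b < d" for j b
    using that by (simp add: \<xi>_def)
  have X: "(\<Sum>c<d * n. (cmod (\<xi> c))\<^sup>2) \<le> X" for n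
  proof -
    have "(\<Sum>c<d * n. (cmod (\<xi> c))\<^sup>2) = (\<Sum>j<n. (vec_norm2 (x j))\<^sup>2)"
      unfolding sum_blocks by (simp add: \<xi> vec_norm2_power2 carrier_vecD[OF carr])
    also have "\<dots> \<le> X"
      unfolding X_def by (rule sum_le_suminf[OF sx]) auto
    finally show ?thesis .
  qed
  have X0: "0 \<le> X" using X[of 0] by simp
  define g where "g r j = (\<Sum>b<d. S r (d * j + b) * \<xi> (d * j + b))" for r j
  have g: "(block d S i j *\<^sub>v x j) $ a = g (d * i + a) j" if "a < d" for i j a
    using block_mult_entry[OF that carr] by (simp add: g_def \<xi>)
  have sg: "summable (g r)" for r
  proof (rule summable_norm_cancel, rule summableI_nonneg_bounded)
    fix n
    have "(\<Sum>j<n. cmod (g r j)) \<le> (\<Sum>c<d * n. cmod (S r c) * cmod (\<xi> c))"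
      unfolding sum_blocks g_def
      by (intro sum_mono order_trans[OF norm_sum]) (simp add: norm_mult)
    also have "\<dots> \<le> \<bar>K\<bar> * sqrt (\<Sum>c<d * (n + Suc r). (cmod (\<xi> c))\<^sup>2)"
      by (rule section_bound_abs_row[OF S d])
    also have "\<dots> \<le> \<bar>K\<bar> * sqrt X"
      by (intro mult_left_mono real_sqrt_le_mono X) auto
    finally show "(\<Sum>j<n. cmod (g r j)) \<le> \<bar>K\<bar> * sqrt X" .
  qed simp
  define T where "T r = suminf (g r)" for r
  have T: "(\<lambda>n. \<Sum>c<d * n. S r c * \<xi> c) \<longlonglongrightarrow> T r" for r
    using summable_LIMSEQ[OF sg[of r]] by (simp add: sum_blocks g_def T_def)
  have bound: "(\<Sum>r<d * m. (cmod (T r))\<^sup>2) \<le> K\<^sup>2 * X" for m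
  proof (rule LIMSEQ_le_const2)
    show "(\<lambda>n. \<Sum>r<d * m. (cmod (\<Sum>c<d * n. S r c * \<xi> c))\<^sup>2) \<longlonglongrightarrow> (\<Sum>r<d * m. (cmod (T r))\<^sup>2)"
      by (intro tendsto_intros T)
    have "(\<Sum>r<d * m. (cmod (\<Sum>c<d * n. S r c * \<xi> c))\<^sup>2) \<le> K\<^sup>2 * X" if "m \<le> n" for n
    proof -
      have "(\<Sum>r<d * m. (cmod (\<Sum>c<d * n. S r c * \<xi> c))\<^sup>2) \<le> (\<Sum>r<d * n. (cmod (\<Sum>c<d * n. S r c * \<xi> c))\<^sup>2)"
        by (rule sum_mono2) (use that in auto)
      also have "\<dots> \<le> K\<^sup>2 * (\<Sum>c<d * n. (cmod (\<xi> c))\<^sup>2)"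
        using S by (simp add: section_bound_def)
      also have "\<dots> \<le> K\<^sup>2 * X"
        by (intro mult_left_mono X) simp
      finally show ?thesis .
    qed
    then show "\<exists>N. \<forall>n\<ge>N. (\<Sum>r<d * m. (cmod (\<Sum>c<d * n. S r c * \<xi> c))\<^sup>2) \<le> K\<^sup>2 * X"
      by blast
  qed
  have apply_eq: "block_apply d S x i = vec d (\<lambda>a. T (d * i + a))" for i
    by (rule eq_vecI) (simp_all add: block_apply_def g T_def)
  have partial: "(\<Sum>i<m. (vec_norm2 (block_apply d S x i))\<^sup>2) \<le> K\<^sup>2 * X" for m
    using bound[of m] unfolding sum_blocks by (simp add: vec_norm2_power2 apply_eq)
  have summ: "summable (\<lambda>i. (vec_norm2 (block_apply d S x i))\<^sup>2)"
    by (rule summableI_nonneg_bounded[OF _ partial]) simp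
  have "l2_norm (block_apply d S x) \<le> sqrt (K\<^sup>2 * X)"
    unfolding l2_norm_def by (intro real_sqrt_le_mono suminf_le_const summ partial)
  then have "l2_norm (block_apply d S x) \<le> \<bar>K\<bar> * l2_norm x"
    by (simp add: real_sqrt_mult l2_norm_def X_def)
  moreover have "\<forall>i. \<forall>a<d. summable (\<lambda>j. (block d S i j *\<^sub>v x j) $ a)"
    using g sg by simp
  moreover have "block_apply d S x \<in> l2_space d"
    using summ by (simp add: l2_space_def apply_eq)
  ultimately show "(\<forall>i. \<forall>a<d. summable (\<lambda>j. (block d S i j *\<^sub>v x j) $ a)) \<and>
      block_apply d S x \<in> l2_space d \<and> l2_norm (block_apply d S x) \<le> \<bar>K\<bar> * l2_norm x"
    by blast
qed

text \<open>Apply the operator to a finite vector extended by zero, and discard the rows of the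
  image beyond the section.\<close>

lemma bounded_on_l2_imp_section_bound:
  assumes "bounded_on_l2 d S"
  shows "\<exists>K. section_bound d S K"
proof -
  obtain C where C: "\<And>x. x \<in> l2_space d \<Longrightarrow> block_apply d S x \<in> l2_space d \<and>
      l2_norm (block_apply d S x) \<le> C * l2_norm x"
    using assms unfolding bounded_on_l2_def by blast
  have "section_bound d S C"
    unfolding section_bound_def
  proof (intro allI)
    fix n and x :: "nat \<Rightarrow> complex"
    define X where "X i = (if i < n then vec d (\<lambda>a. x (d * i + a)) else 0\<^sub>v d)" for i
    have carr: "X i \<in> carrier_vec d" for i by (simp add: X_def)
    have nX: "(vec_norm2 (X i))\<^sup>2 = (if i < n then \<Sum>a<d. (cmod (x (d * i + a)))\<^sup>2 else 0)" for i
      by (simp add: X_def vec_norm2_power2)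
    have X: "X \<in> l2_space d"
      using carr summable_finite[of "{..<n}" "\<lambda>i. (vec_norm2 (X i))\<^sup>2"]
      by (simp add: l2_space_def nX)
    have "(\<Sum>i. (vec_norm2 (X i))\<^sup>2) = (\<Sum>i<n. (vec_norm2 (X i))\<^sup>2)"
      by (rule suminf_finite) (simp_all add: nX)
    also have "\<dots> = (\<Sum>c<d * n. (cmod (x c))\<^sup>2)"
      unfolding sum_blocks by (simp add: nX)
    finally have lX: "(l2_norm X)\<^sup>2 = (\<Sum>c<d * n. (cmod (x c))\<^sup>2)"
      by (simp add: l2_norm_def sum_nonneg)
    have app: "block_apply d S X i $ a = (\<Sum>c<d * n. S (d * i + a) c * x c)" if "a < d" for i a
    proof -
      have "block_apply d S X i $ a = (\<Sum>j. (block d S i j *\<^sub>v X j) $ a)"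
        using that by (simp add: block_apply_def)
      also have "\<dots> = (\<Sum>j<n. (block d S i j *\<^sub>v X j) $ a)"
        by (rule suminf_finite) (use that in \<open>simp_all add: block_mult_entry[OF _ carr] del: index_mult_mat_vec, simp_all add: X_def\<close>)
      also have "\<dots> = (\<Sum>c<d * n. S (d * i + a) c * x c)"
        unfolding sum_blocks using that
        by (simp add: block_mult_entry[OF _ carr] del: index_mult_mat_vec) (simp add: X_def)
      finally show ?thesis .
    qed
    have Y: "summable (\<lambda>i. (vec_norm2 (block_apply d S X i))\<^sup>2)"
      using C[OF X] by (simp add: l2_space_def)
    have "(\<Sum>r<d * n. (cmod (\<Sum>c<d * n. S r c * x c))\<^sup>2) = (\<Sum>i<n. (vec_norm2 (block_apply d S X i))\<^sup>2)"
      unfolding sum_blocks[of _ d n] vec_norm2_power2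
      by (simp add: app[unfolded sum_blocks] block_apply_def[of d S X, THEN arg_cong[where f = dim_vec]])
    also have "\<dots> \<le> (\<Sum>i. (vec_norm2 (block_apply d S X i))\<^sup>2)"
      by (rule sum_le_suminf[OF Y]) auto
    also have "\<dots> = (l2_norm (block_apply d S X))\<^sup>2"
      by (simp add: l2_norm_def suminf_nonneg[OF Y])
    also have "\<dots> \<le> (C * l2_norm X)\<^sup>2"
      using C[OF X] by (intro power_mono) (auto simp: l2_norm_def suminf_nonneg[OF Y])
    finally show "(\<Sum>r<d * n. (cmod (\<Sum>c<d * n. S r c * x c))\<^sup>2) \<le> C\<^sup>2 * (\<Sum>c<d * n. (cmod (x c))\<^sup>2)"
      by (simp add: power_mult_distrib lX)
  qed
  then show ?thesis ..
qed

section \<open>Fejer means\<close>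

text \<open>The Cesaro mean of the Fourier series, written as a sum over a square section so that
  forms of sections can be compared with it directly; \<open>fejer_eq\<close> gives the usual
  weighted sum. For N = 0 division by zero makes it 0.\<close>

definition fejer ::
    "(int \<Rightarrow> nat \<Rightarrow> nat \<Rightarrow> complex) \<Rightarrow> nat \<Rightarrow> real \<Rightarrow> nat \<Rightarrow> nat \<Rightarrow> complex" where
  "fejer A N t a b = (\<Sum>i<N. \<Sum>j<N. A (int i - int j) a b * cis (of_int (int i - int j) * t)) / of_nat N"

text \<open>The Fejer triangle, cut off at 0 to be defined on all integers. For N = 0 it is
  constantly 1 by division by zero, hence the assumptions \<open>0 < N\<close> below.\<close>

definition weight :: "nat \<Rightarrow> int \<Rightarrow> real" where
  "weight N n = max 0 (1 - \<bar>of_int n\<bar> / of_nat N)"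

lemma weight_bounds: "0 \<le> weight N n" "weight N n \<le> 1"
  by (simp_all add: weight_def)

lemma weight_eq_0: "0 < N \<Longrightarrow> n \<notin> {- int N<..<int N} \<Longrightarrow> weight N n = 0"
  by (auto simp: weight_def field_simps abs_if split: if_splits)

lemma tendsto_weight:
  assumes "filterlim N at_top F"
  shows "((\<lambda>j. weight (N j) n) \<longlongrightarrow> 1) F"
proof -
  have "((\<lambda>j. \<bar>of_int n\<bar> / real (N j)) \<longlongrightarrow> 0) F"
    using assms by (intro tendsto_divide_0[OF tendsto_const] filterlim_at_top_imp_at_infinity
        filterlim_compose[OF filterlim_real_sequentially])
  then have "((\<lambda>j. max 0 (1 - \<bar>of_int n\<bar> / real (N j))) \<longlongrightarrow> max 0 (1 - 0)) F"
    by (intro tendsto_intros)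
  then show ?thesis by (simp add: weight_def)
qed

text \<open>The difference n occurs N - |n| times in a square of side N. In the induction the new
  row and the new column together contain each difference from -N to N exactly once.\<close>

lemma sum_differences:
  fixes f :: "int \<Rightarrow> 'a::comm_ring_1"
  shows "(\<Sum>i<N. \<Sum>j<N. f (int i - int j)) = (\<Sum>n\<in>{- int N<..<int N}. of_int (int N - \<bar>n\<bar>) * f n)"
proof (induction N)
  case (Suc N)
  have neg: "(\<Sum>i<N. f (int i - int N)) = (\<Sum>n\<in>{- int N..<0}. f n)"
    by (rule sum.reindex_bij_witness[of _ "\<lambda>n. nat (n + int N)" "\<lambda>i. int i - int N"]) auto
  have pos: "(\<Sum>j<Suc N. f (int N - int j)) = (\<Sum>n\<in>{0..int N}. f n)"
    by (rule sum.reindex_bij_witness[of _ "\<lambda>n. nat (int N - n)" "\<lambda>j. int N - int j"]) auto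
  have "(\<Sum>i<Suc N. \<Sum>j<Suc N. f (int i - int j)) =
      (\<Sum>i<N. \<Sum>j<N. f (int i - int j)) + ((\<Sum>i<N. f (int i - int N)) + (\<Sum>j<Suc N. f (int N - int j)))"
    by (simp add: sum.distrib)
  also have "(\<Sum>i<N. f (int i - int N)) + (\<Sum>j<Suc N. f (int N - int j)) = (\<Sum>n\<in>{- int N..int N}. f n)"
    unfolding neg pos by (subst sum.union_disjoint[symmetric]) (auto intro: sum.cong)
  also have "(\<Sum>i<N. \<Sum>j<N. f (int i - int j)) = (\<Sum>n\<in>{- int N..int N}. of_int (int N - \<bar>n\<bar>) * f n)"
    unfolding Suc.IH by (rule sum.mono_neutral_left) (auto simp: abs_if)
  also have "\<dots> + (\<Sum>n\<in>{- int N..int N}. f n) = (\<Sum>n\<in>{- int N..int N}. of_int (int (Suc N) - \<bar>n\<bar>) * f n)"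
    unfolding sum.distrib[symmetric] by (simp add: algebra_simps)
  also have "{- int N..int N} = {- int (Suc N)<..<int (Suc N)}"
    by auto
  finally show ?case .
qed simp

lemma fejer_eq:
  assumes "0 < N"
  shows "fejer A N t a b =
    (\<Sum>n\<in>{- int N<..<int N}. of_real (weight N n) * A n a b * cis (of_int n * t))"
proof -
  have w: "complex_of_int (int N - \<bar>n\<bar>) / of_nat N = of_real (weight N n)" if "n \<in> {- int N<..<int N}" for n
  proof -
    have "weight N n = of_int (int N - \<bar>n\<bar>) / of_nat N"
      using that assms by (auto simp: weight_def field_simps max_def abs_le_iff)
    then show ?thesis by (simp only: of_real_divide of_real_of_int_eq of_real_of_nat_eq)
  qed
  show ?thesis
    unfolding fejer_def sum_differences[of "\<lambda>n. A n a b * cis (of_int n * t)"] sum_divide_distrib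
    by (intro sum.cong refl) (simp add: w[symmetric])
qed

text \<open>Test the section on the plane wave that carries y in every block with phase
  \<open>cis (- i * t)\<close> in block i; the phases then combine to those of the mean.\<close>

lemma fejer_psd:
  assumes "psd (d * N) (toep d A)"
  shows "psd d (fejer A N t)"
  unfolding psd_def
proof
  fix y :: "nat \<Rightarrow> complex"
  define x where "x r = y (r mod d) * cis (- (of_nat (r div d) * t))" for r
  have cis: "cis (of_int (int i - int j) * t) = cnj (cis (- (of_nat i * t))) * cis (- (of_nat j * t))"
    for i j
    by (simp add: cis_cnj cis_mult left_diff_distrib)
  have "sesq (d * N) (toep d A) x x =
      (\<Sum>i<N. \<Sum>a<d. \<Sum>j<N. \<Sum>b<d. cnj (y a) * (A (int i - int j) a b * cis (of_int (int i - int j) * t)) * y b)"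
    unfolding sesq_toep cis by (intro sum.cong refl) (simp add: x_def)
  also have "\<dots> = (\<Sum>a<d. \<Sum>i<N. \<Sum>b<d. \<Sum>j<N. cnj (y a) * (A (int i - int j) a b * cis (of_int (int i - int j) * t)) * y b)"
    by (subst sum.swap) (intro sum.cong refl sum.swap)
  also have "\<dots> = (\<Sum>a<d. \<Sum>b<d. \<Sum>i<N. \<Sum>j<N. cnj (y a) * (A (int i - int j) a b * cis (of_int (int i - int j) * t)) * y b)"
    by (intro sum.cong refl sum.swap)
  also have "\<dots> / of_nat N = sesq d (fejer A N t) y y"
    unfolding sesq_def fejer_def
    by (simp only: sum_divide_distrib sum_distrib_left sum_distrib_right times_divide_eq_left
        times_divide_eq_right)
  finally have "sesq d (fejer A N t) y y = of_real (1 / of_nat N) * sesq (d * N) (toep d A) x x"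
    by simp
  moreover have "0 \<le> sesq (d * N) (toep d A) x x"
    using assms by (simp add: psd_def)
  ultimately show "0 \<le> sesq d (fejer A N t) y y"
    by (simp add: less_eq_complex_def)
qed

text \<open>The plane wave supported on component b of each block has squared norm N. The mean is
  1/N times a sum, with unimodular factors, of component a of the image over the N blocks, so
  Cauchy-Schwarz costs a factor sqrt N, the section bound gives |K| sqrt N, and the division by N
  cancels both roots.\<close>

lemma fejer_bound:
  assumes S: "section_bound d (toep d A) K" and ab: "a < d" "b < d"
  shows "cmod (fejer A N t a b) \<le> \<bar>K\<bar>"
proof -
  define x :: "nat \<Rightarrow> complex"
    where "x r = (if r mod d = b then cis (- (of_nat (r div d) * t)) else 0)" for r
  define u where "u i = cmod (\<Sum>j<N. A (int i - int j) a b * cis (- (of_nat j * t)))" for i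
  have row: "(\<Sum>c<d * N. toep d A (d * i + a) c * x c) = (\<Sum>j<N. A (int i - int j) a b * cis (- (of_nat j * t)))" for i
    unfolding sum_blocks using ab
    by (intro sum.cong refl) (simp add: toep_block x_def if_distrib[of "\<lambda>u. _ * u"] cong: if_cong)
  have "(\<Sum>i<N. (u i)\<^sup>2) \<le> (\<Sum>i<N. \<Sum>a<d. (cmod (\<Sum>c<d * N. toep d A (d * i + a) c * x c))\<^sup>2)"
    unfolding u_def row[symmetric] using ab by (intro sum_mono member_le_sum) auto
  also have "\<dots> \<le> K\<^sup>2 * (\<Sum>c<d * N. (cmod (x c))\<^sup>2)"
    using S[unfolded section_bound_def, rule_format, of x N]
    unfolding sum_blocks[of "\<lambda>r. (cmod (\<Sum>c<d * N. toep d A r c * x c))\<^sup>2"] .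
  also have "(\<Sum>c<d * N. (cmod (x c))\<^sup>2) = of_nat N"
    unfolding sum_blocks using ab
    by (simp add: x_def if_distrib[of cmod] if_distrib[of "\<lambda>u. u\<^sup>2"] cong: if_cong)
  finally have "(\<Sum>i<N. (u i)\<^sup>2) \<le> K\<^sup>2 * of_nat N" .
  then have "(\<Sum>i<N. (u i)\<^sup>2) * of_nat N \<le> K\<^sup>2 * of_nat N * of_nat N"
    by (rule mult_right_mono) simp
  with sum_squared_le_sum_of_squares[of u "{..<N}"]
  have "(\<Sum>i<N. u i)\<^sup>2 \<le> (\<bar>K\<bar> * of_nat N)\<^sup>2"
    by (simp add: power_mult_distrib power2_eq_square[of "real N"] mult_ac)
  then have u: "(\<Sum>i<N. u i) \<le> \<bar>K\<bar> * of_nat N"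
    by (rule power2_le_imp_le) simp
  have "(\<Sum>i<N. \<Sum>j<N. A (int i - int j) a b * cis (of_int (int i - int j) * t)) =
      (\<Sum>i<N. cis (of_nat i * t) * (\<Sum>j<N. A (int i - int j) a b * cis (- (of_nat j * t))))"
    unfolding sum_distrib_left
    by (intro sum.cong refl) (simp add: mult.left_commute cis_mult left_diff_distrib)
  then have "cmod (fejer A N t a b) = cmod (\<Sum>i<N. cis (of_nat i * t) *
      (\<Sum>j<N. A (int i - int j) a b * cis (- (of_nat j * t)))) / of_nat N"
    by (simp add: fejer_def norm_divide)
  also have "\<dots> \<le> (\<Sum>i<N. u i) / of_nat N"
    by (intro divide_right_mono order_trans[OF norm_sum]) (simp_all add: norm_mult u_def)
  also have "\<dots> \<le> \<bar>K\<bar>"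
    using u by (cases "N = 0") (simp_all add: field_simps)
  finally show ?thesis .
qed

section \<open>Trigonometric polynomials and Parseval's identity\<close>

lemma integral_trig_poly:
  assumes "finite I"
  shows "integrable circ (\<lambda>t. \<Sum>n\<in>I. b n * cis (of_int n * t))"
    and "(LINT t|circ. (\<Sum>n\<in>I. b n * cis (of_int n * t))) = (if 0 \<in> I then 2 * of_real pi * b 0 else 0)"
proof -
  have int: "integrable circ (\<lambda>t. b n * cis (of_int n * t))" for n
    by (intro integrable_mult_right continuous_imp_integrable_real continuous_intros)
  then show "integrable circ (\<lambda>t. \<Sum>n\<in>I. b n * cis (of_int n * t))"
    by (intro Bochner_Integration.integrable_sum)
  have "(LINT t|circ. (\<Sum>n\<in>I. b n * cis (of_int n * t))) = (\<Sum>n\<in>I. LINT t|circ. b n * cis (of_int n * t))"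
    by (rule Bochner_Integration.integral_sum[OF int])
  also have "\<dots> = (\<Sum>n\<in>I. if n = 0 then 2 * of_real pi * b 0 else 0)"
    by (intro sum.cong refl) (simp add: integral_cis)
  also have "\<dots> = (if 0 \<in> I then 2 * of_real pi * b 0 else 0)"
    using assms by simp
  finally show "(LINT t|circ. (\<Sum>n\<in>I. b n * cis (of_int n * t))) = (if 0 \<in> I then 2 * of_real pi * b 0 else 0)" .
qed

lemma parseval:
  assumes I: "finite I"
  shows "integrable circ (\<lambda>t. (cmod (\<Sum>n\<in>I. b n * cis (of_int n * t)))\<^sup>2)"
    and "(LINT t|circ. (cmod (\<Sum>n\<in>I. b n * cis (of_int n * t)))\<^sup>2) = 2 * pi * (\<Sum>n\<in>I. (cmod (b n))\<^sup>2)"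
proof -
  let ?p = "\<lambda>t. \<Sum>n\<in>I. b n * cis (of_int n * t)"
  have int: "integrable circ (\<lambda>t. b n * cnj (b m) * cis (of_int (n - m) * t))" for n m
    by (intro integrable_mult_right continuous_imp_integrable_real continuous_intros)
  have sq: "of_real ((cmod (?p t))\<^sup>2) = (\<Sum>n\<in>I. \<Sum>m\<in>I. b n * cnj (b m) * cis (of_int (n - m) * t))" for t
    unfolding complex_norm_square cnj_sum sum_product
  proof (intro sum.cong refl)
    fix n m
    have "cis (of_int n * t) * cnj (cis (of_int m * t)) = cis (of_int (n - m) * t)"
      by (simp add: cis_cnj cis_mult left_diff_distrib)
    then show "b n * cis (of_int n * t) * cnj (b m * cis (of_int m * t)) =
        b n * cnj (b m) * cis (of_int (n - m) * t)"
      by (simp add: mult_ac)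
  qed
  have "has_bochner_integral circ (\<lambda>t. of_real ((cmod (?p t))\<^sup>2) :: complex)
      (\<Sum>n\<in>I. \<Sum>m\<in>I. LINT t|circ. b n * cnj (b m) * cis (of_int (n - m) * t))"
    unfolding sq by (intro has_bochner_integral_sum has_bochner_integral_integrable int)
  also have "(\<Sum>n\<in>I. \<Sum>m\<in>I. LINT t|circ. b n * cnj (b m) * cis (of_int (n - m) * t)) =
      (\<Sum>n\<in>I. \<Sum>m\<in>I. if m = n then 2 * of_real pi * of_real ((cmod (b n))\<^sup>2) else 0)"
    unfolding integral_mult_right_zero integral_cis
    by (intro sum.cong refl) (auto simp: complex_norm_square simp del: of_real_power)
  also have "\<dots> = of_real (2 * pi * (\<Sum>n\<in>I. (cmod (b n))\<^sup>2))"
    using I by (simp add: sum_distrib_left)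
  finally have "has_bochner_integral circ (\<lambda>t. Re (of_real ((cmod (?p t))\<^sup>2)))
      (Re (of_real (2 * pi * (\<Sum>n\<in>I. (cmod (b n))\<^sup>2))))"
    by (rule has_bochner_integral_Re)
  then have *: "has_bochner_integral circ (\<lambda>t. (cmod (?p t))\<^sup>2) (2 * pi * (\<Sum>n\<in>I. (cmod (b n))\<^sup>2))"
    by (simp only: Re_complex_of_real)
  show "integrable circ (\<lambda>t. (cmod (?p t))\<^sup>2)"
    using * by (simp add: has_bochner_integral_iff)
  show "(LINT t|circ. (cmod (?p t))\<^sup>2) = 2 * pi * (\<Sum>n\<in>I. (cmod (b n))\<^sup>2)"
    using * by (rule has_bochner_integral_integral_eq)
qed

lemma measure_circ: "measure circ (space circ) = 2 * pi"
  unfolding measure_def emeasure_circ by simp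

text \<open>Parseval applied to the uniformly bounded means bounds the weighted square sums; on a
  fixed window of indices the weights tend to 1.\<close>

lemma fejer_square_sum:
  assumes S: "section_bound d (toep d A) K" and ab: "a < d" "b < d"
  shows "(\<Sum>n\<in>{- int M<..<int M}. (cmod (A n a b))\<^sup>2) \<le> K\<^sup>2"
proof (rule LIMSEQ_le_const2)
  interpret finite_measure circ by (rule finite_measure_circ)
  show "(\<lambda>N. \<Sum>n\<in>{- int M<..<int M}. (cmod (of_real (weight N n) * A n a b))\<^sup>2)
      \<longlonglongrightarrow> (\<Sum>n\<in>{- int M<..<int M}. (cmod (A n a b))\<^sup>2)"
  proof (rule tendsto_sum)
    fix n
    have "(\<lambda>N. (cmod (of_real (weight N n) * A n a b))\<^sup>2) \<longlonglongrightarrow> (cmod (of_real 1 * A n a b))\<^sup>2"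
      by (intro tendsto_intros tendsto_weight[OF filterlim_ident])
    then show "(\<lambda>N. (cmod (of_real (weight N n) * A n a b))\<^sup>2) \<longlonglongrightarrow> (cmod (A n a b))\<^sup>2"
      by simp
  qed
  \<comment> \<open>\<open>Suc M\<close> instead of \<open>M\<close> keeps N positive also for M =
    0, as \<open>fejer_eq\<close> requires.\<close>
  have "(\<Sum>n\<in>{- int M<..<int M}. (cmod (of_real (weight N n) * A n a b))\<^sup>2) \<le> K\<^sup>2" if N: "Suc M \<le> N" for N
  proof -
    let ?S = "\<lambda>M. \<Sum>n\<in>{- int M<..<int M}. (cmod (of_real (weight N n) * A n a b))\<^sup>2"
    have "2 * pi * ?S N = (LINT t|circ. (cmod (fejer A N t a b))\<^sup>2)"
      using N by (subst parseval(2)[symmetric]) (simp_all add: fejer_eq)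
    also have "\<dots> \<le> (LINT t|circ. K\<^sup>2)"
    proof (rule integral_mono)
      show "integrable circ (\<lambda>t. (cmod (fejer A N t a b))\<^sup>2)"
        using parseval(1)[of "{- int N<..<int N}" "\<lambda>n. of_real (weight N n) * A n a b"] N
        by (simp add: fejer_eq)
      show "(cmod (fejer A N t a b))\<^sup>2 \<le> K\<^sup>2" for t
        using power_mono[OF fejer_bound[OF S ab, of N t], of 2] by simp
    qed simp
    also have "(LINT t|circ. K\<^sup>2) = 2 * pi * K\<^sup>2"
      by (simp only: lebesgue_integral_const measure_circ) simp
    finally have "?S N \<le> K\<^sup>2" by simp
    moreover have "?S M \<le> ?S N"
      by (rule sum_mono2) (use N in auto)
    ultimately show ?thesis by simp
  qed
  then show "\<exists>N0. \<forall>N\<ge>N0. (\<Sum>n\<in>{- int M<..<int M}. (cmod (of_real (weight N n) * A n a b))\<^sup>2) \<le> K\<^sup>2"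
    by blast
qed

section \<open>Almost everywhere convergence along a sparse sequence of lengths\<close>

lemma weight_sparse_sequence:
  fixes e :: "int \<Rightarrow> real"
  assumes nonneg: "\<And>n. 0 \<le> e n" and B: "\<And>M. (\<Sum>n\<in>{- int M<..<int M}. e n) \<le> B"
  obtains N :: "nat \<Rightarrow> nat" where "\<And>j. j < N j"
    "\<And>j M. (\<Sum>n\<in>{- int M<..<int M}. (1 - weight (N j) n)\<^sup>2 * e n) \<le> (1/4) ^ j"
proof -
  define s where "s M = (\<Sum>n\<in>{- int M<..<int M}. e n)" for M
  have mono: "s M \<le> s M'" if "M \<le> M'" for M M'
    unfolding s_def by (rule sum_mono2) (use that nonneg in auto)
  \<comment> \<open>Up to the factor 2 pi, this sum is the squared mean-square distance from the
    mean of length N to the formal Fourier series. It is split at an index M0 beyond which the tail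
    of e is below \<epsilon> / 2; the geometric target chosen for \<epsilon> at the end makes
    consecutive differences summable.\<close>
  have "\<exists>N>j. \<forall>M. (\<Sum>n\<in>{- int M<..<int M}. (1 - weight N n)\<^sup>2 * e n) \<le> \<epsilon>" if \<epsilon>: "0 < \<epsilon>" for \<epsilon> :: real and j
  proof -
    have bdd: "bdd_above (range s)"
      using B by (intro bdd_aboveI[of _ B]) (auto simp: s_def)
    define L where "L = (SUP M. s M)"
    have L: "s M \<le> L" for M
      unfolding L_def by (rule cSUP_upper[OF _ bdd]) simp
    have "\<exists>M\<in>UNIV. L - \<epsilon> / 2 < s M"
      unfolding L_def using \<epsilon> by (subst less_cSUP_iff[OF _ bdd, symmetric]) auto
    then obtain M0 where M0: "L - \<epsilon> / 2 < s M0" by blast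
    \<comment> \<open>For |n| < M0 the defect \<open>1 - weight N n\<close> is at most M0 / N, so
      the head contributes at most this quantity.\<close>
    have "(\<lambda>N. (real M0 / real N)\<^sup>2 * B) \<longlonglongrightarrow> 0\<^sup>2 * B"
      by (intro tendsto_intros tendsto_divide_0[OF tendsto_const]
          filterlim_at_top_imp_at_infinity filterlim_real_sequentially)
    then have "\<forall>\<^sub>F N in sequentially. (real M0 / real N)\<^sup>2 * B < \<epsilon> / 2"
      by (rule order_tendstoD) (use \<epsilon> in simp)
    with eventually_gt_at_top[of j]
    have "\<forall>\<^sub>F N in sequentially. j < N \<and> (real M0 / real N)\<^sup>2 * B < \<epsilon> / 2"
      by eventually_elim simp
    then obtain N where N: "j < N" "(real M0 / real N)\<^sup>2 * B < \<epsilon> / 2"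
      by (auto simp: eventually_sequentially)
    have "(\<Sum>n\<in>{- int M<..<int M}. (1 - weight N n)\<^sup>2 * e n) \<le> \<epsilon>" for M
    proof -
      define M' where "M' = max M M0"
      define I where "I = {- int M0<..<int M0}"
      define I' where "I' = {- int M'<..<int M'}"
      have sub: "I \<subseteq> I'" "finite I'" by (auto simp: I_def I'_def M'_def)
      have "(\<Sum>n\<in>{- int M<..<int M}. (1 - weight N n)\<^sup>2 * e n) \<le> (\<Sum>n\<in>I'. (1 - weight N n)\<^sup>2 * e n)"
        by (rule sum_mono2) (auto simp: I'_def M'_def nonneg)
      also have "\<dots> = (\<Sum>n\<in>I' - I. (1 - weight N n)\<^sup>2 * e n) + (\<Sum>n\<in>I. (1 - weight N n)\<^sup>2 * e n)"
        by (rule sum.subset_diff[OF sub])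
      also have "(\<Sum>n\<in>I' - I. (1 - weight N n)\<^sup>2 * e n) \<le> (\<Sum>n\<in>I' - I. 1 * e n)"
        by (intro sum_mono mult_right_mono nonneg power_le_one) (auto simp: weight_bounds)
      also have "(\<Sum>n\<in>I' - I. 1 * e n) = s M' - s M0"
        using sum.subset_diff[OF sub, of e] by (simp add: s_def I_def I'_def)
      also have "(\<Sum>n\<in>I. (1 - weight N n)\<^sup>2 * e n) \<le> (\<Sum>n\<in>I. (real M0 / real N)\<^sup>2 * e n)"
      proof (intro sum_mono mult_right_mono nonneg power_mono)
        fix n assume "n \<in> I"
        then have "\<bar>real_of_int n\<bar> \<le> real M0" by (auto simp: I_def abs_le_iff)
        then have "\<bar>real_of_int n\<bar> / real N \<le> real M0 / real N" by (rule divide_right_mono) simp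
        then show "1 - weight N n \<le> real M0 / real N" by (simp add: weight_def)
      qed (simp add: weight_bounds)
      also have "\<dots> \<le> (real M0 / real N)\<^sup>2 * B"
        unfolding sum_distrib_left[symmetric] I_def by (intro mult_left_mono B) simp
      finally show ?thesis using N(2) M0 L[of M'] by linarith
    qed
    with N(1) show ?thesis by blast
  qed
  then have "\<exists>N>j. \<forall>M. (\<Sum>n\<in>{- int M<..<int M}. (1 - weight N n)\<^sup>2 * e n) \<le> (1/4) ^ j" for j
    by simp
  then show ?thesis using that by metis
qed

text \<open>Sum and integral of nonnegative functions commute, so the series of norms has a finite
  integral and is therefore finite almost everywhere.\<close>

lemma AE_summable_if_summable_integral:
  fixes g :: "nat \<Rightarrow> 'a \<Rightarrow> 'b::{banach, second_countable_topology}"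
  assumes int: "\<And>j. integrable M (g j)" and r: "\<And>j. (LINT t|M. norm (g j t)) \<le> r j" "summable r"
  shows "AE t in M. summable (\<lambda>j. g j t)"
proof -
  have [measurable]: "g j \<in> borel_measurable M" for j
    using int by auto
  have r0: "0 \<le> r j" for j
    by (rule order_trans[OF _ r(1)]) simp
  have "(\<integral>\<^sup>+t. (\<Sum>j. ennreal (norm (g j t))) \<partial>M) = (\<Sum>j. \<integral>\<^sup>+t. ennreal (norm (g j t)) \<partial>M)"
    by (rule nn_integral_suminf) measurable
  also have "\<dots> \<le> (\<Sum>j. ennreal (r j))"
    using r(1) by (intro suminf_le) (auto simp: nn_integral_eq_integral[OF integrable_norm[OF int]] ennreal_leI)
  also have "\<dots> = ennreal (suminf r)"
    by (rule suminf_ennreal2[OF r0 r(2)])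
  also have "\<dots> < \<infinity>" by simp
  finally have "AE t in M. (\<Sum>j. ennreal (norm (g j t))) \<noteq> \<infinity>"
    by (intro nn_integral_PInf_AE) auto
  then show ?thesis
    by eventually_elim (rule summable_norm_cancel, rule summable_suminf_not_top, simp_all)
qed

text \<open>Consecutive means differ by a polynomial of mean square of order
  \<open>(1/4) ^ j\<close>, hence of mean absolute value of order \<open>(1/2) ^ j\<close>. The
  telescoping series of differences thus converges almost everywhere.\<close>

lemma AE_convergent_means:
  fixes c :: "int \<Rightarrow> complex"
  assumes c: "\<And>n. (cmod (c n))\<^sup>2 \<le> e n"
    and N: "\<And>j. 0 < N j"
    and e: "\<And>j M. (\<Sum>n\<in>{- int M<..<int M}. (1 - weight (N j) n)\<^sup>2 * e n) \<le> (1/4) ^ j"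
  shows "AE t in circ. convergent
    (\<lambda>j. \<Sum>n\<in>{- int (N j)<..<int (N j)}. of_real (weight (N j) n) * c n * cis (of_int n * t))"
proof -
  define f where "f j t = (\<Sum>n\<in>{- int (N j)<..<int (N j)}. of_real (weight (N j) n) * c n * cis (of_int n * t))" for j t
  define b where "b j n = of_real (weight (N (Suc j)) n - weight (N j) n) * c n" for j n
  \<comment> \<open>A window containing the supports of both means, so that they can be subtracted
    coefficient by coefficient.\<close>
  define I where "I j = {- int (max (N j) (N (Suc j)))<..<int (max (N j) (N (Suc j)))}" for j
  define g where "g j t = (\<Sum>n\<in>I j. b j n * cis (of_int n * t))" for j t
  have fin: "finite (I j)" for j by (simp add: I_def)
  have f_eq: "f i t = (\<Sum>n\<in>I j. of_real (weight (N i) n) * c n * cis (of_int n * t))"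
    if "i = j \<or> i = Suc j" for i j t
    unfolding f_def using that
    by (intro sum.mono_neutral_left) (auto simp: I_def weight_eq_0[OF N])
  have g: "g j t = f (Suc j) t - f j t" for j t
    unfolding f_eq[of j j, simplified] f_eq[of "Suc j" j, simplified]
    by (simp add: g_def b_def sum_subtractf[symmetric] algebra_simps)
  have intg: "integrable circ (g j)" for j
    unfolding g_def by (rule integral_trig_poly(1)[OF fin])
  have sq: "(\<Sum>n\<in>I j. (cmod (b j n))\<^sup>2) \<le> 4 * (1/4) ^ j" for j
  proof -
    have "(cmod (b j n))\<^sup>2 \<le> 2 * ((1 - weight (N j) n)\<^sup>2 * e n) + 2 * ((1 - weight (N (Suc j)) n)\<^sup>2 * e n)" for n
    proof -
      let ?u = "1 - weight (N j) n" and ?v = "1 - weight (N (Suc j)) n"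
      have e0: "0 \<le> e n" by (rule order_trans[OF _ c]) simp
      have "(cmod (b j n))\<^sup>2 = (?u - ?v)\<^sup>2 * (cmod (c n))\<^sup>2"
        by (simp add: b_def norm_mult power_mult_distrib del: of_real_diff)
      also have "\<dots> \<le> (?u - ?v)\<^sup>2 * e n"
        by (intro mult_left_mono c) simp
      also have "\<dots> \<le> (2 * ?u\<^sup>2 + 2 * ?v\<^sup>2) * e n"
        by (intro mult_right_mono e0) (use sum_squares_ge_zero[of "?u + ?v" 0] in \<open>simp add: power2_eq_square algebra_simps\<close>)
      finally show ?thesis by (simp add: algebra_simps)
    qed
    then have "(\<Sum>n\<in>I j. (cmod (b j n))\<^sup>2) \<le>
        (\<Sum>n\<in>I j. 2 * ((1 - weight (N j) n)\<^sup>2 * e n) + 2 * ((1 - weight (N (Suc j)) n)\<^sup>2 * e n))"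
      by (rule sum_mono)
    also have "\<dots> = 2 * (\<Sum>n\<in>I j. (1 - weight (N j) n)\<^sup>2 * e n) + 2 * (\<Sum>n\<in>I j. (1 - weight (N (Suc j)) n)\<^sup>2 * e n)"
      by (simp add: sum.distrib sum_distrib_left)
    also have "\<dots> \<le> 2 * (1/4) ^ j + 2 * (1/4) ^ Suc j"
      unfolding I_def by (intro add_mono mult_left_mono e) auto
    also have "\<dots> \<le> 4 * (1/4) ^ j" by simp
    finally show ?thesis .
  qed
  have L1: "(LINT t|circ. cmod (g j t)) \<le> 5 * pi * (1/2) ^ j" for j
  proof -
    interpret finite_measure circ by (rule finite_measure_circ)
    \<comment> \<open>A pointwise substitute for Cauchy-Schwarz. The factor \<open>2 ^ j\<close>
      balances the two terms: the square contributes at most 4 pi and the constant pi, each times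
      \<open>(1/2) ^ j\<close>, which explains the constant 5 pi.\<close>
    have "cmod z \<le> 2 ^ j / 2 * (cmod z)\<^sup>2 + (1/2) ^ j / 2" for z
    proof -
      have le: "x \<le> p / 2 * x\<^sup>2 + q / 2" if "p * q = 1" "0 \<le> q" for p q x :: real
      proof -
        have "0 \<le> (p * x - 1)\<^sup>2 * q" using that by simp
        also have "\<dots> = p * (p * q) * x\<^sup>2 - 2 * (p * q) * x + q"
          by (simp add: power2_eq_square algebra_simps)
        finally show ?thesis using that by simp
      qed
      show ?thesis by (rule le) (simp_all flip: power_mult_distrib)
    qed
    then have "(LINT t|circ. cmod (g j t)) \<le> (LINT t|circ. 2 ^ j / 2 * (cmod (g j t))\<^sup>2 + (1/2) ^ j / 2)"
      using intg[unfolded g_def] parseval(1)[OF fin, of "b j" j]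
      by (intro integral_mono integrable_norm) (auto simp: g_def)
    also have "\<dots> = 2 ^ j / 2 * (LINT t|circ. (cmod (g j t))\<^sup>2) + (LINT t|circ. (1/2) ^ j / 2)"
      using parseval(1)[OF fin, of "b j" j]
      by (subst Bochner_Integration.integral_add) (auto simp: g_def)
    also have "(LINT t|circ. (1/2) ^ j / 2) = pi * (1/2) ^ j"
      by (simp only: lebesgue_integral_const measure_circ) simp
    also have "(LINT t|circ. (cmod (g j t))\<^sup>2) = 2 * pi * (\<Sum>n\<in>I j. (cmod (b j n))\<^sup>2)"
      unfolding g_def by (rule parseval(2)[OF fin])
    also have "2 ^ j / 2 * (2 * pi * (\<Sum>n\<in>I j. (cmod (b j n))\<^sup>2)) \<le> 2 ^ j / 2 * (2 * pi * (4 * (1/4) ^ j))"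
      by (intro mult_left_mono sq) auto
    also have "\<dots> = 4 * pi * (2 * (1/4)) ^ j"
      unfolding power_mult_distrib by simp
    finally show ?thesis by simp
  qed
  have "AE t in circ. summable (\<lambda>j. g j t)"
    by (rule AE_summable_if_summable_integral[OF intg L1]) (intro summable_mult summable_geometric, simp)
  then show ?thesis
    unfolding f_def[symmetric]
  proof eventually_elim
    case (elim t)
    have "f n t = f 0 t + (\<Sum>j<n. g j t)" for n
      unfolding g by (induction n) auto
    then have eq: "(\<lambda>n. f n t) = (\<lambda>n. f 0 t + (\<Sum>j<n. g j t))" ..
    have "convergent (\<lambda>n. f 0 t + (\<Sum>j<n. g j t))"
      using elim by (intro convergent_add convergent_const) (simp add: summable_iff_convergent)
    then show ?case by (subst eq)
  qed
qed

text \<open>Adding up the squares of all entries gives one sequence \<open>e\<close> that dominates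
  each of them, so a single sequence of lengths serves every entry, at the price of finitely many
  null sets.\<close>

lemma AE_convergent_fejer:
  assumes S: "section_bound d (toep d A) K"
  obtains N :: "nat \<Rightarrow> nat" where "\<And>j. 0 < N j" "filterlim N at_top sequentially"
    "AE t in circ. \<forall>a<d. \<forall>b<d. convergent (\<lambda>j. fejer A (N j) t a b)"
proof -
  define e where "e n = (\<Sum>a<d. \<Sum>b<d. (cmod (A n a b))\<^sup>2)" for n
  have bound: "(\<Sum>n\<in>{- int M<..<int M}. e n) \<le> (\<Sum>a<d. \<Sum>b<d. K\<^sup>2)" for M
  proof -
    have "(\<Sum>n\<in>{- int M<..<int M}. e n) = (\<Sum>a<d. \<Sum>b<d. \<Sum>n\<in>{- int M<..<int M}. (cmod (A n a b))\<^sup>2)"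
      unfolding e_def by (subst sum.swap) (intro sum.cong refl sum.swap)
    also have "\<dots> \<le> (\<Sum>a<d. \<Sum>b<d. K\<^sup>2)"
      by (intro sum_mono fejer_square_sum[OF S]) auto
    finally show ?thesis .
  qed
  have nonneg: "0 \<le> e n" for n
    unfolding e_def by (intro sum_nonneg) auto
  obtain N where N: "\<And>j. j < N j"
    "\<And>j M. (\<Sum>n\<in>{- int M<..<int M}. (1 - weight (N j) n)\<^sup>2 * e n) \<le> (1/4) ^ j"
    using weight_sparse_sequence[OF nonneg bound] by blast
  have pos: "0 < N j" for j
    using N(1)[of j] by simp
  have "AE t in circ. convergent (\<lambda>j. fejer A (N j) t a b)" if "a < d" "b < d" for a b
    unfolding fejer_eq[OF pos]
  proof (rule AE_convergent_means[OF _ pos N(2)])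
    fix n
    have "(cmod (A n a b))\<^sup>2 \<le> (\<Sum>b<d. (cmod (A n a b))\<^sup>2)"
      using that by (intro member_le_sum) auto
    also have "\<dots> \<le> e n"
      unfolding e_def using that by (intro member_le_sum) (auto intro: sum_nonneg)
    finally show "(cmod (A n a b))\<^sup>2 \<le> e n" .
  qed
  then have "AE t in circ. \<forall>a\<in>{..<d}. \<forall>b\<in>{..<d}. convergent (\<lambda>j. fejer A (N j) t a b)"
    by (intro AE_finite_allI) auto
  then have "AE t in circ. \<forall>a<d. \<forall>b<d. convergent (\<lambda>j. fejer A (N j) t a b)"
    by eventually_elim auto
  moreover have "filterlim N at_top sequentially"
    by (rule filterlim_at_top_mono[OF filterlim_ident always_eventually])
      (use N(1) in \<open>auto intro: less_imp_le\<close>)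
  ultimately show ?thesis
    using that pos by blast
qed

section \<open>Properties of the means, and the limiting symbol\<close>

lemma fejer_measurable [measurable]: "(\<lambda>t. fejer A N t a b) \<in> borel_measurable circ"
  unfolding fejer_def by measurable

lemma fejer_minus_pi: "fejer A N (- pi) a b = fejer A N pi a b"
proof -
  have "cis (of_int m * (- pi)) = cis (of_int m * pi)" for m
    by (simp add: complex_eq_iff mult.commute)
  then show ?thesis by (simp only: fejer_def)
qed

text \<open>The weight at index 0 is 1, so constants are reproduced without loss.\<close>

lemma fejer_add_const:
  assumes "0 < N"
  shows "fejer (\<lambda>n a b. A n a b + (if n = 0 then c a b else 0)) N t a b = fejer A N t a b + c a b"
proof -
  have "(\<Sum>n\<in>{- int N<..<int N}. of_real (weight N n) * (if n = 0 then c a b else 0) * cis (of_int n * t))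
      = (\<Sum>n\<in>{- int N<..<int N}. if n = 0 then c a b else 0)"
    by (intro sum.cong refl) (auto simp: weight_def)
  also have "\<dots> = c a b" using assms by simp
  finally show ?thesis
    by (simp add: fejer_eq[OF assms] distrib_left distrib_right sum.distrib)
qed

text \<open>The conjugate of the term at (i, j) is the term at (j, i), so conjugation only swaps the
  order of summation.\<close>

lemma fejer_real:
  assumes "\<And>n. cnj (A n a b) = A n a b" "\<And>n. A (- n) a b = A n a b"
  shows "fejer A N t a b \<in> \<real>"
proof -
  have "cnj (A n a b * cis (of_int n * t)) = A (- n) a b * cis (of_int (- n) * t)" for n
    using assms by (simp add: cis_cnj)
  then have "cnj (fejer A N t a b) =
      (\<Sum>i<N. \<Sum>j<N. A (- (int i - int j)) a b * cis (of_int (- (int i - int j)) * t)) / of_nat N"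
    by (simp only: fejer_def complex_cnj_divide cnj_sum complex_cnj_of_nat)
  also have "\<dots> = (\<Sum>i<N. \<Sum>j<N. A (int j - int i) a b * cis (of_int (int j - int i) * t)) / of_nat N"
    by (simp only: minus_diff_eq)
  also have "\<dots> = fejer A N t a b"
    unfolding fejer_def by (subst sum.swap) (rule refl)
  finally show ?thesis by (simp add: Reals_cnj_iff)
qed

lemma fcoef_fejer:
  assumes "0 < N"
  shows "fcoef (fejer A N) m a b = of_real (weight N m) * A m a b"
proof -
  let ?I = "{- int N<..<int N}"
  have "fejer A N t a b * cis (- (of_int m * t)) =
      (\<Sum>n\<in>(\<lambda>n. n - m) ` ?I. of_real (weight N (n + m)) * A (n + m) a b * cis (of_int n * t))" for t
  proof -
    have "cis (of_int n * t) * cis (- (of_int m * t)) = cis (of_int (n - m) * t)" for n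
      by (simp add: cis_mult left_diff_distrib)
    then show ?thesis
      by (subst sum.reindex) (auto simp: inj_on_def fejer_eq[OF assms] sum_distrib_right mult.assoc)
  qed
  then have "(LINT t|circ. fejer A N t a b * cis (- (of_int m * t))) =
      (if 0 \<in> (\<lambda>n. n - m) ` ?I then 2 * of_real pi * (of_real (weight N (0 + m)) * A (0 + m) a b) else 0)"
    by (simp only: integral_trig_poly(2)[OF finite_imageI[OF finite_greaterThanLessThan_int]])
  moreover have "0 \<in> (\<lambda>n. n - m) ` ?I \<longleftrightarrow> m \<in> ?I"
    by auto
  ultimately show ?thesis
    using weight_eq_0[OF assms, of m] by (auto simp: fcoef_def)
qed

text \<open>A bounded block Toeplitz matrix comes from a bounded symbol: the coefficients are square summable,
  so the Fejer means are Cauchy in mean and converge almost everywhere along a subsequence;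
  everything needed of the symbol then passes from the means to the limit.\<close>

lemma bounded_symbol_exists:
  assumes S: "section_bound d (toep d A) K"
  obtains N :: "nat \<Rightarrow> nat" and G :: "real \<Rightarrow> nat \<Rightarrow> nat \<Rightarrow> complex" where
    "\<And>j. 0 < N j"
    "AE t in circ. \<forall>a<d. \<forall>b<d. (\<lambda>j. fejer A (N j) t a b) \<longlonglongrightarrow> G t a b"
    "\<And>a b. (\<lambda>t. G t a b) \<in> borel_measurable circ"
    "AE t in circ. \<forall>a<d. \<forall>b<d. cmod (G t a b) \<le> \<bar>K\<bar>"
    "G (- pi) = G pi"
    "\<And>m a b. a < d \<Longrightarrow> b < d \<Longrightarrow> fcoef G m a b = A m a b"
proof -
  obtain N where N: "\<And>j. 0 < N j" "filterlim N at_top sequentially"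
    and conv: "AE t in circ. \<forall>a<d. \<forall>b<d. convergent (\<lambda>j. fejer A (N j) t a b)"
    using AE_convergent_fejer[OF S] by blast
  define G where "G t a b = lim (\<lambda>j. fejer A (N j) t a b)" for t a b
  have lim: "AE t in circ. \<forall>a<d. \<forall>b<d. (\<lambda>j. fejer A (N j) t a b) \<longlonglongrightarrow> G t a b"
    using conv by eventually_elim (simp add: G_def convergent_LIMSEQ_iff)
  have meas: "(\<lambda>t. G t a b) \<in> borel_measurable circ" for a b
    unfolding G_def by (rule borel_measurable_lim_metric) measurable
  have bound: "AE t in circ. \<forall>a<d. \<forall>b<d. cmod (G t a b) \<le> \<bar>K\<bar>"
    using lim
  proof eventually_elim
    case (elim t)
    show ?case
    proof (intro allI impI)
      fix a b assume ab: "a < d" "b < d"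
      show "cmod (G t a b) \<le> \<bar>K\<bar>"
        by (rule LIMSEQ_le_const2[OF tendsto_norm[OF elim[rule_format, OF ab]]])
          (intro exI allI impI fejer_bound[OF S ab])
    qed
  qed
  have coef: "fcoef G m a b = A m a b" if ab: "a < d" "b < d" for m a b
  proof -
    interpret finite_measure circ by (rule finite_measure_circ)
    have "(\<lambda>j. LINT t|circ. fejer A (N j) t a b * cis (- (of_int m * t)))
        \<longlonglongrightarrow> (LINT t|circ. G t a b * cis (- (of_int m * t)))"
    proof (rule integral_dominated_convergence[where w = "\<lambda>_. \<bar>K\<bar>"])
      have m: "(\<lambda>t. cis (- (of_int m * t))) \<in> borel_measurable circ"
        using measurable_cis[of "- of_int m"] by (simp only: mult_minus_left)
      show "(\<lambda>t. G t a b * cis (- (of_int m * t))) \<in> borel_measurable circ"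
        by (intro borel_measurable_times meas m)
      show "(\<lambda>t. fejer A (N j) t a b * cis (- (of_int m * t))) \<in> borel_measurable circ" for j
        by (intro borel_measurable_times fejer_measurable m)
      show "AE t in circ. (\<lambda>j. fejer A (N j) t a b * cis (- (of_int m * t)))
          \<longlonglongrightarrow> G t a b * cis (- (of_int m * t))"
        using lim by eventually_elim (use ab in \<open>auto intro!: tendsto_intros\<close>)
      show "AE t in circ. cmod (fejer A (N j) t a b * cis (- (of_int m * t))) \<le> \<bar>K\<bar>" for j
        using fejer_bound[OF S ab] by (simp add: norm_mult)
    qed simp
    then have "(\<lambda>j. fcoef (fejer A (N j)) m a b) \<longlonglongrightarrow> fcoef G m a b"
      unfolding fcoef_def by (intro tendsto_intros)
    moreover have "(\<lambda>j. of_real (weight (N j) m) * A m a b) \<longlonglongrightarrow> of_real 1 * A m a b"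
      by (intro tendsto_intros tendsto_weight N)
    ultimately show ?thesis
      unfolding fcoef_fejer[OF N(1)] by (metis LIMSEQ_unique mult_1 of_real_1)
  qed
  \<comment> \<open>The sequences of means at the two endpoints are equal, so \<open>lim\<close>
    returns the same value whether or not they converge.\<close>
  have "G (- pi) = G pi"
    by (intro ext) (simp add: G_def fejer_minus_pi)
  then show ?thesis
    using that N(1) lim meas bound coef by blast
qed

lemma symbol_psd:
  assumes N: "\<And>j. 0 < N j"
    and lim: "\<forall>a<d. \<forall>b<d. (\<lambda>j. fejer A (N j) t a b) \<longlonglongrightarrow> g a b"
    and psd: "\<And>n. psd (d * n) (toep d (\<lambda>n a b. A n a b + (if n = 0 then c a b else 0)))"
  shows "psd d (\<lambda>a b. g a b + c a b)"
proof (rule psd_limit)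
  show "psd d (\<lambda>a b. fejer A (N j) t a b + c a b)" for j
  proof -
    have "fejer (\<lambda>n a b. A n a b + (if n = 0 then c a b else 0)) (N j) t = (\<lambda>a b. fejer A (N j) t a b + c a b)"
      by (intro ext fejer_add_const N)
    then show ?thesis using fejer_psd[OF psd, of "N j" t] by simp
  qed
  show "(\<lambda>j. fejer A (N j) t a b + c a b) \<longlonglongrightarrow> g a b + c a b" if "a < d" "b < d" for a b
    using lim that by (intro tendsto_intros) auto
qed

section \<open>The essential range\<close>

lemma vec_norm2_le_sum: "vec_norm2 v \<le> (\<Sum>i<dim_vec v. cmod (v $ i))"
  unfolding vec_norm2_def by (rule L2_set_le_sum) simp

lemma vec_index_le_norm2: "i < dim_vec v \<Longrightarrow> cmod (v $ i) \<le> vec_norm2 v"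
  unfolding vec_norm2_def by (rule member_le_L2_set) auto

lemma vec_norm2_mult_le:
  assumes M: "M \<in> carrier_mat d d" and v: "v \<in> carrier_vec d" "vec_norm2 v \<le> 1"
  shows "vec_norm2 (M *\<^sub>v v) \<le> (\<Sum>a<d. \<Sum>b<d. cmod (M $$ (a, b)))"
proof -
  have "cmod ((M *\<^sub>v v) $ a) \<le> (\<Sum>b<d. cmod (M $$ (a, b)))" if "a < d" for a
  proof -
    have "(M *\<^sub>v v) $ a = (\<Sum>b<d. M $$ (a, b) * v $ b)"
      using M v that by (simp add: scalar_prod_def atLeast0LessThan)
    also have "cmod \<dots> \<le> (\<Sum>b<d. cmod (M $$ (a, b)) * 1)"
    proof (rule order_trans[OF norm_sum sum_mono], unfold norm_mult, rule mult_left_mono)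
      fix b assume "b \<in> {..<d}"
      then show "cmod (v $ b) \<le> 1"
        using vec_index_le_norm2[of b v] v by simp
    qed simp
    finally show ?thesis by simp
  qed
  then have "(\<Sum>a<d. cmod ((M *\<^sub>v v) $ a)) \<le> (\<Sum>a<d. \<Sum>b<d. cmod (M $$ (a, b)))"
    by (intro sum_mono) simp
  moreover have "vec_norm2 (M *\<^sub>v v) \<le> (\<Sum>a<d. cmod ((M *\<^sub>v v) $ a))"
    using vec_norm2_le_sum[of "M *\<^sub>v v"] M by simp
  ultimately show ?thesis by simp
qed

lemma mat_norm_upper:
  assumes M: "M \<in> carrier_mat d d" and v: "v \<in> carrier_vec d" "vec_norm2 v \<le> 1"
  shows "vec_norm2 (M *\<^sub>v v) \<le> mat_norm M"
  unfolding mat_norm_def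
proof (rule cSUP_upper)
  show "v \<in> {v \<in> carrier_vec (dim_col M). vec_norm2 v \<le> 1}" using M v by simp
  show "bdd_above ((\<lambda>v. vec_norm2 (M *\<^sub>v v)) ` {v \<in> carrier_vec (dim_col M). vec_norm2 v \<le> 1})"
    by (rule bdd_aboveI2, rule vec_norm2_mult_le[OF M]) (use M in auto)
qed

lemma mat_norm_least:
  assumes M: "M \<in> carrier_mat d d"
    and B: "\<And>v. v \<in> carrier_vec d \<Longrightarrow> vec_norm2 v \<le> 1 \<Longrightarrow> vec_norm2 (M *\<^sub>v v) \<le> B"
  shows "mat_norm M \<le> B"
  unfolding mat_norm_def
proof (rule cSUP_least)
  have "0\<^sub>v d \<in> {v \<in> carrier_vec (dim_col M). vec_norm2 v \<le> 1}"
    using M by (simp add: vec_norm2_def L2_set_def)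
  then show "{v \<in> carrier_vec (dim_col M). vec_norm2 v \<le> 1} \<noteq> {}" by blast
qed (use B M in auto)

lemma mat_norm_le_sum:
  assumes "M \<in> carrier_mat d d"
  shows "mat_norm M \<le> (\<Sum>a<d. \<Sum>b<d. cmod (M $$ (a, b)))"
  by (rule mat_norm_least[OF assms vec_norm2_mult_le[OF assms]])

lemma mat_entry_le_mat_norm:
  assumes M: "M \<in> carrier_mat d d" and ab: "a < d" "b < d"
  shows "cmod (M $$ (a, b)) \<le> mat_norm M"
proof -
  let ?e = "unit_vec d b :: complex vec"
  have "(\<Sum>i<d. (cmod (?e $ i))\<^sup>2) = (\<Sum>i<d. if i = b then 1 else 0)"
    by (intro sum.cong refl) (use ab in auto)
  then have "vec_norm2 ?e \<le> 1"
    using ab by (simp add: vec_norm2_def L2_set_def)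
  then have "vec_norm2 (M *\<^sub>v ?e) \<le> mat_norm M"
    by (intro mat_norm_upper[OF M]) auto
  moreover have "(M *\<^sub>v ?e) $ a = M $$ (a, b)"
    using M ab by simp
  ultimately show ?thesis
    using vec_index_le_norm2[of a "M *\<^sub>v ?e"] M ab by simp
qed

lemma mat_norm_triangle:
  assumes M: "M \<in> carrier_mat d d" and N: "N \<in> carrier_mat d d"
  shows "mat_norm (M + N) \<le> mat_norm M + mat_norm N"
proof (rule mat_norm_least)
  fix v :: "complex vec" assume v: "v \<in> carrier_vec d" "vec_norm2 v \<le> 1"
  have "(M + N) *\<^sub>v v = M *\<^sub>v v + N *\<^sub>v v"
    by (rule add_mult_distrib_mat_vec[OF M N v(1)])
  then have "vec_norm2 ((M + N) *\<^sub>v v) = L2_set (\<lambda>i. cmod ((M *\<^sub>v v) $ i + (N *\<^sub>v v) $ i)) {..<d}"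
    using M N unfolding vec_norm2_def by (intro L2_set_cong) auto
  also have "\<dots> \<le> L2_set (\<lambda>i. cmod ((M *\<^sub>v v) $ i) + cmod ((N *\<^sub>v v) $ i)) {..<d}"
    by (rule L2_set_mono) (auto intro: norm_triangle_ineq)
  also have "\<dots> \<le> vec_norm2 (M *\<^sub>v v) + vec_norm2 (N *\<^sub>v v)"
    using M N unfolding vec_norm2_def by (auto intro: L2_set_triangle_ineq)
  also have "\<dots> \<le> mat_norm M + mat_norm N"
    by (intro add_mono mat_norm_upper[OF _ v] M N)
  finally show "vec_norm2 ((M + N) *\<^sub>v v) \<le> mat_norm M + mat_norm N" .
qed (use M N in auto)

lemma mat_norm_diff_triangle:
  assumes "A \<in> carrier_mat d d" "B \<in> carrier_mat d d" "C \<in> carrier_mat d d"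
  shows "mat_norm (A - C) \<le> mat_norm (A - B) + mat_norm (B - C)"
proof -
  have "A - C = (A - B) + (B - C)"
    using assms by (intro eq_matI) auto
  then show ?thesis
    using mat_norm_triangle[OF minus_carrier_mat[OF assms(2)] minus_carrier_mat[OF assms(3)]] by simp
qed

text \<open>It dominates the operator norm of the difference, and as a finite sum of entries it is
  evidently measurable along the symbol.\<close>

definition entry_dist :: "nat \<Rightarrow> complex mat \<Rightarrow> complex mat \<Rightarrow> real" where
  "entry_dist d M N = (\<Sum>a<d. \<Sum>b<d. cmod (M $$ (a, b) - N $$ (a, b)))"

lemma entry_dist_commute: "entry_dist d M N = entry_dist d N M"
  by (simp add: entry_dist_def norm_minus_commute)

lemma mat_norm_diff_le:
  assumes "M \<in> carrier_mat d d" "N \<in> carrier_mat d d"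
  shows "mat_norm (M - N) \<le> entry_dist d M N"
proof -
  have "mat_norm (M - N) \<le> (\<Sum>a<d. \<Sum>b<d. cmod ((M - N) $$ (a, b)))"
    using assms by (intro mat_norm_le_sum) auto
  also have "\<dots> = entry_dist d M N"
    unfolding entry_dist_def using assms by (intro sum.cong refl) auto
  finally show ?thesis .
qed

lemma countable_dense_matrices:
  obtains D where "countable D" "D \<subseteq> carrier_mat d d"
    "\<And>M \<epsilon>. \<epsilon> > 0 \<Longrightarrow> \<exists>Q\<in>D. entry_dist d M Q < \<epsilon>"
proof -
  obtain E :: "complex set" where E: "countable E" "\<And>X. open X \<Longrightarrow> X \<noteq> {} \<Longrightarrow> \<exists>e\<in>E. e \<in> X"
    using countable_dense_setE by blast
  define D where "D = (\<lambda>f. mat d d f) ` (\<Pi>\<^sub>E p\<in>{..<d} \<times> {..<d}. E)"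
  have "countable D"
    unfolding D_def using E(1) by (intro countable_image countable_PiE) auto
  moreover have "D \<subseteq> carrier_mat d d" by (auto simp: D_def)
  moreover have "\<exists>Q\<in>D. entry_dist d M Q < \<epsilon>" if \<epsilon>: "\<epsilon> > 0" for M \<epsilon>
  proof -
    \<comment> \<open>The summand 1 keeps the denominator positive for d = 0 and makes the final
      estimate strict.\<close>
    define \<delta> where "\<delta> = \<epsilon> / (of_nat d * of_nat d + 1)"
    have \<delta>: "0 < \<delta>" unfolding \<delta>_def using \<epsilon> by (intro divide_pos_pos) (auto intro: add_nonneg_pos)
    have "\<exists>e\<in>E. dist (M $$ p) e < \<delta>" for p
      using E(2)[of "ball (M $$ p) \<delta>"] \<delta> by auto
    then obtain f where f: "\<And>p. f p \<in> E" "\<And>p. dist (M $$ p) (f p) < \<delta>" by metis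
    let ?f = "restrict f ({..<d} \<times> {..<d})"
    have "entry_dist d M (mat d d ?f) \<le> (\<Sum>a<d. \<Sum>b<d. \<delta>)"
      unfolding entry_dist_def using f(2) by (intro sum_mono) (auto simp: dist_norm intro: less_imp_le)
    also have "\<dots> = (of_nat d * of_nat d) * \<delta>" by simp
    also have "\<dots> < (of_nat d * of_nat d + 1) * \<delta>"
      using \<delta> by (intro mult_strict_right_mono) auto
    also have "\<dots> = \<epsilon>"
      unfolding \<delta>_def by (simp add: add_nonneg_pos less_imp_neq[symmetric] add_nonneg_eq_0_iff)
    finally have "entry_dist d M (mat d d ?f) < \<epsilon>" .
    moreover have "?f \<in> (\<Pi>\<^sub>E p\<in>{..<d} \<times> {..<d}. E)"
      using f(1) by (simp only: restrict_PiE_iff) blast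
    ultimately show ?thesis unfolding D_def by blast
  qed
  ultimately show ?thesis using that by blast
qed

section \<open>Measurability of norm balls and almost everywhere membership\<close>

context
  fixes d :: nat and F :: "real \<Rightarrow> complex mat"
  assumes carr: "\<And>t. t \<in> {-pi..pi} \<Longrightarrow> F t \<in> carrier_mat d d"
    and meas: "\<And>a b. a < d \<Longrightarrow> b < d \<Longrightarrow> (\<lambda>t. F t $$ (a, b)) \<in> borel_measurable circ"
begin

lemma sets_entry_dist: "{t \<in> {-pi..pi}. entry_dist d (F t) Q < c} \<in> sets lebesgue"
proof -
  have "(\<lambda>t. cmod (F t $$ (a, b) - Q $$ (a, b))) \<in> borel_measurable circ" if "a < d" "b < d" for a b
    using meas[OF that] by measurable
  then have "(\<lambda>t. entry_dist d (F t) Q) \<in> borel_measurable circ"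
    unfolding entry_dist_def by (intro borel_measurable_sum) auto
  then have "{t \<in> space circ. entry_dist d (F t) Q < c} \<in> sets circ"
    by measurable
  then show ?thesis
    by (subst (asm) sets_restrict_space_iff) auto
qed

text \<open>The ball is a countable union of small entrywise balls centred at matrices of a dense
  set, restricted to those that the triangle inequality places inside it.\<close>

lemma sets_mat_norm_ball:
  assumes B: "B \<in> carrier_mat d d"
  shows "{t \<in> {-pi..pi}. mat_norm (F t - B) < \<epsilon>} \<in> sets lebesgue"
proof -
  obtain D where D: "countable D" "D \<subseteq> carrier_mat d d"
    "\<And>M \<epsilon>. \<epsilon> > 0 \<Longrightarrow> \<exists>Q\<in>D. entry_dist d M Q < \<epsilon>"
    using countable_dense_matrices by blast
  let ?U = "\<lambda>Q m. {t \<in> {-pi..pi}. entry_dist d (F t) Q < inverse (real (Suc m)) \<and>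
      mat_norm (Q - B) + inverse (real (Suc m)) < \<epsilon>}"
  have "{t \<in> {-pi..pi}. mat_norm (F t - B) < \<epsilon>} = (\<Union>Q\<in>D. \<Union>m. ?U Q m)"
  proof (intro equalityI subsetI)
    fix t assume "t \<in> {t \<in> {-pi..pi}. mat_norm (F t - B) < \<epsilon>}"
    then have t: "t \<in> {-pi..pi}" "0 < \<epsilon> - mat_norm (F t - B)" by auto
    \<comment> \<open>Half of the gap covers the distance from F t to Q, the other half the radius
      added in \<open>?U\<close>.\<close>
    obtain m where m: "inverse (real (Suc m)) < (\<epsilon> - mat_norm (F t - B)) / 2"
      using reals_Archimedean[of "(\<epsilon> - mat_norm (F t - B)) / 2"] t by auto
    obtain Q where Q: "Q \<in> D" "entry_dist d (F t) Q < inverse (real (Suc m))"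
      using D(3)[of "inverse (real (Suc m))" "F t"] by auto
    have Qc: "Q \<in> carrier_mat d d" using D(2) Q(1) by blast
    have "mat_norm (Q - B) \<le> mat_norm (Q - F t) + mat_norm (F t - B)"
      by (rule mat_norm_diff_triangle[OF Qc carr[OF t(1)] B])
    moreover have "mat_norm (Q - F t) \<le> entry_dist d (F t) Q"
      using mat_norm_diff_le[OF Qc carr[OF t(1)]] by (simp add: entry_dist_commute)
    then have "mat_norm (Q - B) + inverse (real (Suc m)) < \<epsilon>"
    proof -
      have "q + \<delta> < \<epsilon>" if "q \<le> p + x" "p \<le> e" "e < \<delta>" "\<delta> < (\<epsilon> - x) / 2" for q p x e \<delta> :: real
        using that by argo
      from this[OF \<open>mat_norm (Q - B) \<le> _\<close> \<open>mat_norm (Q - F t) \<le> _\<close> Q(2) m] show ?thesis .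
    qed
    then show "t \<in> (\<Union>Q\<in>D. \<Union>m. ?U Q m)" using Q t(1) by blast
  next
    fix t assume "t \<in> (\<Union>Q\<in>D. \<Union>m. ?U Q m)"
    then obtain Q m where Q: "Q \<in> D" "t \<in> {-pi..pi}" "entry_dist d (F t) Q < inverse (real (Suc m))"
      "mat_norm (Q - B) + inverse (real (Suc m)) < \<epsilon>" by blast
    have Qc: "Q \<in> carrier_mat d d" using D(2) Q(1) by blast
    have "mat_norm (F t - B) \<le> mat_norm (F t - Q) + mat_norm (Q - B)"
      by (rule mat_norm_diff_triangle[OF carr[OF Q(2)] Qc B])
    moreover have "mat_norm (F t - Q) \<le> entry_dist d (F t) Q"
      by (rule mat_norm_diff_le[OF carr[OF Q(2)] Qc])
    ultimately show "t \<in> {t \<in> {-pi..pi}. mat_norm (F t - B) < \<epsilon>}"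
      using Q by simp
  qed
  moreover have "?U Q m \<in> sets lebesgue" for Q m
    using sets_entry_dist[of Q "inverse (real (Suc m))"]
    by (cases "mat_norm (Q - B) + inverse (real (Suc m)) < \<epsilon>") simp_all
  then have "(\<Union>Q\<in>D. \<Union>m. ?U Q m) \<in> sets lebesgue"
    by (intro sets.countable_UN''[OF D(1)] sets.countable_UN''[OF countableI_type])
  ultimately show ?thesis by (simp only:)
qed

text \<open>A Lindelof argument: a value outside the essential range has a neighbourhood with null
  preimage, and this can be shrunk to one of countably many entrywise balls. The exceptional set is
  thus covered by countably many null sets.\<close>

lemma AE_in_essential_range: "AE t in circ. F t \<in> essential_range d F"
proof -
  obtain D where D: "countable D" "D \<subseteq> carrier_mat d d"
    "\<And>M \<epsilon>. \<epsilon> > 0 \<Longrightarrow> \<exists>Q\<in>D. entry_dist d M Q < \<epsilon>"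
    using countable_dense_matrices by blast
  let ?U = "\<lambda>Q m. {t \<in> {-pi..pi}. entry_dist d (F t) Q < inverse (real (Suc m))}"
  have "AE t in circ. emeasure lebesgue (?U Q m) = 0 \<longrightarrow> t \<notin> ?U Q m" for Q m
  proof (cases "emeasure lebesgue (?U Q m) = 0")
    case True
    then have "AE t in lebesgue. t \<notin> ?U Q m"
      by (intro AE_not_in null_setsI sets_entry_dist)
    then show ?thesis
      by (subst AE_restrict_space_iff) auto
  qed simp
  then have "AE t in circ. \<forall>Q\<in>D. \<forall>m. emeasure lebesgue (?U Q m) = 0 \<longrightarrow> t \<notin> ?U Q m"
    using D(1) by (simp only: AE_ball_countable AE_all_countable) blast
  moreover have "AE t in circ. t \<in> {-pi..pi}"
    using AE_space[of circ] by simp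
  ultimately show ?thesis
  proof eventually_elim
    case (elim t)
    note Ft = carr[OF elim(2)]
    have "0 < emeasure lebesgue {s \<in> {-pi..pi}. mat_norm (F s - F t) < \<epsilon>}" if \<epsilon>: "0 < \<epsilon>" for \<epsilon> :: real
    proof -
      obtain m where m: "inverse (real (Suc m)) < \<epsilon> / 2"
        using reals_Archimedean[of "\<epsilon> / 2"] \<epsilon> by auto
      obtain Q where Q: "Q \<in> D" "entry_dist d (F t) Q < inverse (real (Suc m))"
        using D(3)[of "inverse (real (Suc m))" "F t"] by auto
      have Qc: "Q \<in> carrier_mat d d" using D(2) Q(1) by blast
      have "t \<in> ?U Q m" using Q elim(2) by simp
      then have "emeasure lebesgue (?U Q m) \<noteq> 0"
        using elim(1)[rule_format, OF Q(1), of m] by blast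
      then have "0 < emeasure lebesgue (?U Q m)"
        by (simp only: zero_less_iff_neq_zero not_False_eq_True)
      also have "\<dots> \<le> emeasure lebesgue {s \<in> {-pi..pi}. mat_norm (F s - F t) < \<epsilon>}"
      proof (rule emeasure_mono[OF subsetI sets_mat_norm_ball[OF Ft]])
        fix s assume s: "s \<in> ?U Q m"
        have "mat_norm (F s - F t) \<le> mat_norm (F s - Q) + mat_norm (Q - F t)"
          using s by (intro mat_norm_diff_triangle[OF carr Qc Ft]) simp
        moreover have "mat_norm (F s - Q) \<le> entry_dist d (F s) Q"
          using s by (intro mat_norm_diff_le[OF carr Qc]) simp
        moreover have "mat_norm (Q - F t) \<le> entry_dist d (F t) Q"
          using mat_norm_diff_le[OF Qc Ft] by (simp add: entry_dist_commute)
        ultimately show "s \<in> {s \<in> {-pi..pi}. mat_norm (F s - F t) < \<epsilon>}"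
          using s Q(2) m by auto
      qed
      finally show ?thesis .
    qed
    then show ?case
      using Ft by (simp add: essential_range_def)
  qed
qed

lemma essential_range_limit:
  assumes AE: "AE t in circ. P t" and B: "B \<in> essential_range d F"
  obtains s where "\<And>n. s n \<in> {-pi..pi}" "\<And>n. P (s n)"
    "\<And>a b. a < d \<Longrightarrow> b < d \<Longrightarrow> (\<lambda>n. F (s n) $$ (a, b)) \<longlonglongrightarrow> B $$ (a, b)"
proof -
  have Bc: "B \<in> carrier_mat d d" using B by (simp add: essential_range_def)
  have "\<exists>t\<in>{-pi..pi}. P t \<and> mat_norm (F t - B) < inverse (real (Suc n))" for n
  proof (rule ccontr)
    let ?V = "{t \<in> {-pi..pi}. mat_norm (F t - B) < inverse (real (Suc n))}"
    assume none: "\<not> (\<exists>t\<in>{-pi..pi}. P t \<and> mat_norm (F t - B) < inverse (real (Suc n)))"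
    have "AE t in lebesgue. t \<in> {-pi..pi} \<longrightarrow> P t"
      using AE by (subst (asm) AE_restrict_space_iff) auto
    then have "AE t in lebesgue. t \<notin> ?V"
      by eventually_elim (use none in auto)
    then have null: "emeasure lebesgue ?V = 0"
      by (rule AE_iff_measurable[OF sets_mat_norm_ball[OF Bc], THEN iffD1, rotated]) auto
    have "\<forall>\<epsilon>>0. 0 < emeasure lebesgue {t \<in> {-pi..pi}. mat_norm (F t - B) < \<epsilon>}"
      using B unfolding essential_range_def by blast
    moreover have "0 < inverse (real (Suc n))" by simp
    ultimately have "0 < emeasure lebesgue ?V" by blast
    with null show False by (simp only: less_irrefl)
  qed
  then have "\<forall>n. \<exists>t. t \<in> {-pi..pi} \<and> P t \<and> mat_norm (F t - B) < inverse (real (Suc n))"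
    by blast
  from choice[OF this] obtain s where "\<forall>n. s n \<in> {-pi..pi} \<and> P (s n) \<and>
      mat_norm (F (s n) - B) < inverse (real (Suc n))" ..
  then have s: "s n \<in> {-pi..pi}" "P (s n)" "mat_norm (F (s n) - B) < inverse (real (Suc n))" for n
    by blast+
  have "(\<lambda>n. F (s n) $$ (a, b)) \<longlonglongrightarrow> B $$ (a, b)" if ab: "a < d" "b < d" for a b
  proof (rule Lim_null[THEN iffD2], rule Lim_null_comparison)
    have "cmod (F (s n) $$ (a, b) - B $$ (a, b)) \<le> inverse (real (Suc n))" for n
      using mat_entry_le_mat_norm[of "F (s n) - B" d a b] s(3)[of n] carr[OF s(1)[of n]] Bc ab
        minus_carrier_mat[OF Bc] by simp
    then show "\<forall>\<^sub>F n in sequentially. cmod (F (s n) $$ (a, b) - B $$ (a, b)) \<le> inverse (real (Suc n))"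
      by simp
    show "(\<lambda>n. inverse (real (Suc n))) \<longlonglongrightarrow> 0"
      by (rule LIMSEQ_inverse_real_of_nat)
  qed
  then show ?thesis using that s by blast
qed

end

section \<open>The characterization\<close>

lemma toep_add_J:
  assumes "0 < k"
  shows "toep (2 * k) (\<lambda>n a b. A n a b + (if n = 0 then \<i> / 2 * J_entry a b else 0)) =
    (\<lambda>r c. toep (2 * k) A r c + \<i> / 2 * J_entry r c)"
proof (intro ext)
  fix r c
  have "J_entry r c = (if r div (2 * k) = c div (2 * k) then J_entry (r mod (2 * k)) (c mod (2 * k)) else 0)"
    using J_entry_block[of "r mod (2 * k)" k "c mod (2 * k)" "r div (2 * k)" "c div (2 * k)"] assms
    by simp
  then show "toep (2 * k) (\<lambda>n a b. A n a b + (if n = 0 then \<i> / 2 * J_entry a b else 0)) r c =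
      toep (2 * k) A r c + \<i> / 2 * J_entry r c"
    by (simp add: toep_def)
qed

lemma toep_add_diag:
  assumes "0 < d"
  shows "toep d (\<lambda>n a b. (if n = 0 then if a = b then K else 0 else 0) + s * A n a b) =
    (\<lambda>r c. (if r = c then K else 0) + s * toep d A r c)"
proof (intro ext)
  fix r c
  have "r = c \<longleftrightarrow> r div d = c div d \<and> r mod d = c mod d"
    by (metis div_mult_mod_eq)
  then show "toep d (\<lambda>n a b. (if n = 0 then if a = b then K else 0 else 0) + s * A n a b) r c =
      (if r = c then K else 0) + s * toep d A r c"
    by (simp add: toep_def)
qed

lemma G_matrix_truncation_iff:
  "G_matrix (k * n) (map_mat complex_of_real (truncation (2 * k) \<Sigma> n)) \<longleftrightarrow>
    psd (2 * k * n) (\<lambda>r c. of_real (\<Sigma> r c) + \<i> / 2 * J_entry r c)"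
proof -
  let ?M = "map_mat complex_of_real (truncation (2 * k) \<Sigma> n)"
  have "psd (2 * (k * n)) (\<lambda>r c. ?M $$ (r, c) + \<i> / 2 * J_entry r c) \<longleftrightarrow>
      psd (2 * (k * n)) (\<lambda>r c. of_real (\<Sigma> r c) + \<i> / 2 * J_entry r c)"
    by (rule psd_cong) (simp add: truncation_def)
  then show ?thesis
    unfolding G_matrix_iff by (simp add: truncation_def mult.assoc)
qed

lemma fcoef_affine:
  assumes "integrable circ (\<lambda>t. G t a b)"
  shows "fcoef (\<lambda>t a b. c a b + s * G t a b) m a b = (if m = 0 then c a b else 0) + s * fcoef G m a b"
proof -
  have 1: "integrable circ (\<lambda>t. c a b * cis (- (of_int m * t)))"
    by (intro integrable_mult_right continuous_imp_integrable_real continuous_intros)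
  have 2: "integrable circ (\<lambda>t. s * (G t a b * cis (- (of_int m * t))))"
    using integrable_mult_cis[OF assms, of "- of_int m"]
    by (intro integrable_mult_right) (simp only: mult_minus_left)
  have "(LINT t|circ. (c a b + s * G t a b) * cis (- (of_int m * t))) =
      (LINT t|circ. c a b * cis (- (of_int m * t))) + (LINT t|circ. s * (G t a b * cis (- (of_int m * t))))"
    unfolding Bochner_Integration.integral_add[OF 1 2, symmetric] by (simp add: algebra_simps)
  moreover have "(LINT t|circ. cis (- (of_int m * t))) = (if m = 0 then 2 * of_real pi else 0)"
    using integral_cis[of "- m"] by simp
  ultimately show ?thesis
    by (simp add: fcoef_def algebra_simps)
qed

text \<open>A d by d matrix with entries of modulus at most m has operator norm at most d m, by the
  inequality between arithmetic and geometric means applied to each product of coordinates.\<close>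

lemma psd_if_entries_bounded:
  assumes herm: "\<And>a b. a < d \<Longrightarrow> b < d \<Longrightarrow> M b a = cnj (M a b)"
    and bound: "\<And>a b. a < d \<Longrightarrow> b < d \<Longrightarrow> cmod (M a b) \<le> m"
    and K: "of_nat d * m \<le> K"
  shows "psd d (\<lambda>a b. (if a = b then of_real K else 0) + M a b)"
  unfolding psd_def
proof
  fix x :: "nat \<Rightarrow> complex"
  let ?X = "\<Sum>a<d. (cmod (x a))\<^sup>2"
  have real: "sesq d M x x = cnj (sesq d M x x)"
    by (rule sesq_hermitian) (rule herm)
  have "cmod (sesq d M x x) \<le> (\<Sum>a<d. \<Sum>b<d. m / 2 * ((cmod (x a))\<^sup>2 + (cmod (x b))\<^sup>2))"
    unfolding sesq_def
  proof (intro order_trans[OF norm_sum] sum_mono)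
    fix a b assume ab: "a \<in> {..<d}" "b \<in> {..<d}"
    show "cmod (cnj (x a) * M a b * x b) \<le> m / 2 * ((cmod (x a))\<^sup>2 + (cmod (x b))\<^sup>2)"
    proof -
      have "cmod (cnj (x a) * M a b * x b) = cmod (M a b) * (cmod (x a) * cmod (x b))"
        by (simp add: norm_mult)
      also have "\<dots> \<le> m * (cmod (x a) * cmod (x b))"
        using bound[of a b] ab by (intro mult_right_mono) auto
      also have "\<dots> \<le> m * (((cmod (x a))\<^sup>2 + (cmod (x b))\<^sup>2) / 2)"
      proof (rule mult_left_mono)
        show "cmod (x a) * cmod (x b) \<le> ((cmod (x a))\<^sup>2 + (cmod (x b))\<^sup>2) / 2"
          using sum_squares_bound[of "cmod (x a)" "cmod (x b)"] by simp
        show "0 \<le> m" using bound[of a b] ab by (auto intro: order_trans[OF norm_ge_zero])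
      qed
      finally show ?thesis by simp
    qed
  qed
  also have "\<dots> = of_nat d * m * ?X"
    unfolding sum_distrib_left[symmetric] by (simp add: sum.distrib algebra_simps flip: sum_distrib_left)
  also have "\<dots> \<le> K * ?X"
    by (intro mult_right_mono K sum_nonneg) auto
  finally have "cmod (sesq d M x x) \<le> K * ?X" .
  then have "0 \<le> K * ?X + Re (sesq d M x x)"
    using abs_Re_le_cmod[of "sesq d M x x"] by linarith
  moreover have "Im (sesq d M x x) = 0"
    using arg_cong[OF real, of Im] by simp
  ultimately show "0 \<le> sesq d (\<lambda>a b. (if a = b then of_real K else 0) + M a b) x x"
    unfolding sesq_add_mat sesq_diag by (simp add: less_eq_complex_def)
qed

lemma integrable_if_AE_bounded:
  fixes f :: "real \<Rightarrow> complex"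
  assumes "f \<in> borel_measurable circ" "AE t in circ. cmod (f t) \<le> C"
  shows "integrable circ f"
proof -
  interpret finite_measure circ by (rule finite_measure_circ)
  show ?thesis using assms by (intro integrable_const_bound)
qed

text \<open>For large K both K + G and K - G are positive almost everywhere;
  \<open>psd_toep_fcoef\<close> carries this to the sections, where
  \<open>section_bound_if_psd\<close> reads it as a norm bound.\<close>

lemma section_bound_symbol:
  assumes d: "0 < d"
    and meas: "\<And>a b. a < d \<Longrightarrow> b < d \<Longrightarrow> (\<lambda>t. G t a b) \<in> borel_measurable circ"
    and bound: "AE t in circ. \<forall>a<d. \<forall>b<d. cmod (G t a b) \<le> C"
    and herm: "AE t in circ. \<forall>a<d. \<forall>b<d. G t b a = cnj (G t a b)"
  obtains K where "section_bound d (toep d (fcoef G)) K"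
proof -
  \<comment> \<open>The product d C dominates the norm of G t; the maximum with 1 supplies the
    positivity of K, by which \<open>section_bound_if_psd\<close> divides.\<close>
  define K where "K = max 1 (of_nat d * C)"
  have int: "integrable circ (\<lambda>t. G t a b)" if "a < d" "b < d" for a b
    by (rule integrable_if_AE_bounded[OF meas[OF that]]) (use bound that in \<open>auto elim: eventually_mono\<close>)
  have *: "psd (d * n) (\<lambda>r c. (if r = c then of_real K else 0) + s * toep d (fcoef G) r c)"
    if s: "s = 1 \<or> s = - 1" for s n
  proof -
    let ?H = "\<lambda>t a b. (if a = b then of_real K else 0) + s * G t a b"
    have "psd (d * n) (toep d (fcoef ?H))"
    proof (rule psd_toep_fcoef)
      show "integrable circ (\<lambda>t. ?H t a b)" if "a < d" "b < d" for a b
      proof -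
        interpret finite_measure circ by (rule finite_measure_circ)
        show ?thesis by (intro Bochner_Integration.integrable_add integrable_mult_right int that) auto
      qed
      show "AE t in circ. psd d (?H t)"
        using bound herm
      proof eventually_elim
        case (elim t)
        show ?case
        proof (rule psd_if_entries_bounded)
          show "s * G t b a = cnj (s * G t a b)" if "a < d" "b < d" for a b
            using elim(2)[rule_format, OF that] s by auto
          show "cmod (s * G t a b) \<le> C" if "a < d" "b < d" for a b
            using elim(1)[rule_format, OF that] s by (auto simp: norm_mult)
        qed (simp add: K_def)
      qed
    qed
    moreover have "toep d (fcoef ?H) r c =
        toep d (\<lambda>n a b. (if n = 0 then if a = b then of_real K else 0 else 0) + s * fcoef G n a b) r c" for r c
      using d unfolding toep_def
      by (subst fcoef_affine[where c = "\<lambda>a b. if a = b then of_real K else 0"]) (simp_all add: int)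
    ultimately show ?thesis
      unfolding toep_add_diag[OF d, symmetric] by (simp add: psd_cong[of "d * n" "toep d (fcoef ?H)"])
  qed
  have "section_bound d (toep d (fcoef G)) K"
  proof (rule section_bound_if_psd)
    show "psd (d * n) (\<lambda>r c. (if r = c then of_real K else 0) - toep d (fcoef G) r c)" for n
      using *[of "- 1" n] by simp
    show "psd (d * n) (\<lambda>r c. (if r = c then of_real K else 0) + toep d (fcoef G) r c)" for n
      using *[of 1 n] by simp
  qed (simp add: K_def)
  then show ?thesis using that by blast
qed

text \<open>Together with realness of the coefficients this turns a real symbol into partial
  symmetry.\<close>

lemma fcoef_uminus:
  assumes "AE t in circ. G t a b \<in> \<real>" "(\<lambda>t. G t a b) \<in> borel_measurable circ"
  shows "fcoef G (- m) a b = cnj (fcoef G m a b)"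
proof -
  have m: "(\<lambda>t. G t a b * cis (of_int n * t)) \<in> borel_measurable circ" for n
    by (intro borel_measurable_times assms(2) measurable_cis)
  have "(LINT t|circ. cnj (G t a b * cis (of_int (- m) * t))) = (LINT t|circ. G t a b * cis (of_int m * t))"
  proof (rule integral_cong_AE)
    show "(\<lambda>t. cnj (G t a b * cis (of_int (- m) * t))) \<in> borel_measurable circ"
      by (rule measurable_compose[OF m[of "- m"] borel_measurable_continuous_onI]) (intro continuous_intros)
    show "AE t in circ. cnj (G t a b * cis (of_int (- m) * t)) = G t a b * cis (of_int m * t)"
      using assms(1) by eventually_elim (simp add: cis_cnj Reals_cnj_iff)
  qed (rule m)
  then have "(LINT t|circ. G t a b * cis (of_int m * t)) = cnj (LINT t|circ. G t a b * cis (of_int (- m) * t))"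
    by (simp only: Bochner_Integration.integral_cnj)
  then show ?thesis by (simp add: fcoef_def)
qed

lemma symbol_of_chain:
  assumes k: "0 < k" and chain: "stationary_G_chain k \<Sigma>"
    and bounded: "bounded_on_l2 (2 * k) (\<lambda>r c. complex_of_real (\<Sigma> r c))"
    and sym: "partially_symmetric k \<Sigma>"
  shows "\<exists>F \<in> L_inf (2 * k). (\<lambda>r c. complex_of_real (\<Sigma> r c)) = toeplitz_of_symbol (2 * k) F \<and>
    (\<forall>B \<in> essential_range (2 * k) F. G_matrix k B)"
proof -
  define d where "d = 2 * k"
  have d: "0 < d" using k by (simp add: d_def)
  \<comment> \<open>The coefficients are taken from \<open>partially_symmetric\<close>, whose
    witness comes with the symmetry.\<close>
  obtain R :: "int \<Rightarrow> real mat" where R: "\<Sigma> = block_toeplitz (2 * k) R" and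
    symR: "\<And>n :: nat. R (- int n) = R (int n)"
    using sym unfolding partially_symmetric_def by blast
  define A where "A n a b = complex_of_real (R n $$ (a, b))" for n a b
  have symA: "A (- n) a b = A n a b" for n a b
    using symR by (cases n rule: int_cases2) (simp_all add: A_def)
  have S: "(\<lambda>r c. complex_of_real (\<Sigma> r c)) = toep d A"
    by (simp add: R block_toeplitz_def toep_def A_def d_def fun_eq_iff)
  obtain K where K: "section_bound d (toep d A) K"
    using bounded_on_l2_imp_section_bound[OF bounded] by (auto simp: S d_def)
  obtain N G where N: "\<And>j. 0 < N j"
    and lim: "AE t in circ. \<forall>a<d. \<forall>b<d. (\<lambda>j. fejer A (N j) t a b) \<longlonglongrightarrow> G t a b"
    and meas: "\<And>a b. (\<lambda>t. G t a b) \<in> borel_measurable circ"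
    and bound: "AE t in circ. \<forall>a<d. \<forall>b<d. cmod (G t a b) \<le> \<bar>K\<bar>"
    and per: "G (- pi) = G pi"
    and coef: "\<And>m a b. a < d \<Longrightarrow> b < d \<Longrightarrow> fcoef G m a b = A m a b"
    using bounded_symbol_exists[OF K] by blast
  define F where "F t = mat d d (\<lambda>(a, b). G t a b)" for t
  have F: "F t $$ (a, b) = G t a b" if "a < d" "b < d" for t a b
    using that by (simp add: F_def)
  have "psd (d * n) (toep d (\<lambda>n a b. A n a b + (if n = 0 then \<i> / 2 * J_entry a b else 0)))" for n
  \<comment> \<open>The chain condition starts at n = 1; for n = 0 the form is an empty sum.\<close>
  proof (cases "n = 0")
    case False
    then have "psd (d * n) (\<lambda>r c. of_real (\<Sigma> r c) + \<i> / 2 * J_entry r c)"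
      using chain unfolding stationary_G_chain_def G_matrix_truncation_iff d_def by simp
    then show ?thesis
      unfolding d_def toep_add_J[OF k] by (simp add: fun_cong[OF fun_cong[OF S]] flip: d_def)
  qed (simp add: psd_def sesq_def)
  from symbol_psd[OF N _ this] lim
  have psd: "AE t in circ. psd d (\<lambda>a b. G t a b + \<i> / 2 * J_entry a b)"
    by (auto elim: eventually_mono)
  have real: "AE t in circ. \<forall>a<d. \<forall>b<d. G t a b \<in> \<real>"
    using lim
  proof eventually_elim
    case (elim t)
    have fejer: "fejer A (N j) t a b \<in> \<real>" for j a b
      by (rule fejer_real) (simp_all add: symA, simp add: A_def)
    show ?case
      by (intro allI impI closed_sequentially[OF closed_complex_Reals fejer]) (rule elim[rule_format])
  qed
  have carr: "F t \<in> carrier_mat d d" for t by (simp add: F_def)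
  have measF: "(\<lambda>t. F t $$ (a, b)) \<in> borel_measurable circ" if "a < d" "b < d" for a b
    using meas F[OF that] by simp
  have "F \<in> L_inf d"
  proof -
    have "\<exists>C. AE t in circ. cmod (F t $$ (a, b)) \<le> C" if "a < d" "b < d" for a b
      using bound that by (intro exI[of _ "\<bar>K\<bar>"]) (auto simp: F elim: eventually_mono)
    then show ?thesis
      using carr measF per by (simp add: L_inf_def) (simp add: F_def)
  qed
  moreover have "toep d A = toeplitz_of_symbol d F"
  proof -
    have "fcoef (\<lambda>t a b. F t $$ (a, b)) m a b = fcoef G m a b" if "a < d" "b < d" for m a b
      by (simp add: fcoef_def F that)
    then show ?thesis
      using d by (simp add: toeplitz_of_symbol_eq_toep toep_def coef fun_eq_iff)
  qed
  moreover have "G_matrix k B" if B: "B \<in> essential_range d F" for B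
  proof -
    \<comment> \<open>Joined in one predicate, so that a single approximating sequence has both
      properties.\<close>
    have good: "AE t in circ. psd d (\<lambda>a b. G t a b + \<i> / 2 * J_entry a b) \<and> (\<forall>a<d. \<forall>b<d. G t a b \<in> \<real>)"
      using psd real by eventually_elim simp
    have ex: "\<exists>s. (\<forall>n. psd d (\<lambda>a b. G (s n) a b + \<i> / 2 * J_entry a b) \<and> (\<forall>a<d. \<forall>b<d. G (s n) a b \<in> \<real>)) \<and>
        (\<forall>a<d. \<forall>b<d. (\<lambda>n. F (s n) $$ (a, b)) \<longlonglongrightarrow> B $$ (a, b))"
    proof (rule essential_range_limit[OF carr measF good B])
      fix s
      assume "\<And>n. psd d (\<lambda>a b. G (s n) a b + \<i> / 2 * J_entry a b) \<and> (\<forall>a<d. \<forall>b<d. G (s n) a b \<in> \<real>)"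
        "\<And>a b. a < d \<Longrightarrow> b < d \<Longrightarrow> (\<lambda>n. F (s n) $$ (a, b)) \<longlonglongrightarrow> B $$ (a, b)"
      then show ?thesis by (intro exI[of _ s]) simp
    qed
    obtain s where s: "\<And>n. psd d (\<lambda>a b. G (s n) a b + \<i> / 2 * J_entry a b) \<and> (\<forall>a<d. \<forall>b<d. G (s n) a b \<in> \<real>)"
      and lim_s: "\<And>a b. a < d \<Longrightarrow> b < d \<Longrightarrow> (\<lambda>n. F (s n) $$ (a, b)) \<longlonglongrightarrow> B $$ (a, b)"
      using ex by blast
    have l: "(\<lambda>n. G (s n) a b) \<longlonglongrightarrow> B $$ (a, b)" if "a < d" "b < d" for a b
      using lim_s[OF that] by (simp add: F that)
    have "psd d (\<lambda>a b. B $$ (a, b) + \<i> / 2 * J_entry a b)"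
    proof (rule psd_limit)
      show "psd d (\<lambda>a b. G (s n) a b + \<i> / 2 * J_entry a b)" for n
        using s by blast
      show "(\<lambda>n. G (s n) a b + \<i> / 2 * J_entry a b) \<longlonglongrightarrow> B $$ (a, b) + \<i> / 2 * J_entry a b"
        if "a < d" "b < d" for a b
        by (intro tendsto_intros l that)
    qed
    moreover have "B $$ (a, b) \<in> \<real>" if "a < d" "b < d" for a b
      by (rule closed_sequentially[OF closed_complex_Reals _ l[OF that]]) (use s that in blast)
    moreover have "B \<in> carrier_mat d d"
      using B by (simp add: essential_range_def)
    ultimately show ?thesis
      by (simp add: G_matrix_iff d_def)
  qed
  ultimately show ?thesis
    unfolding d_def[symmetric] S by blast
qed

lemma chain_of_symbol:
  assumes k: "0 < k" and F: "F \<in> L_inf (2 * k)"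
    and S: "(\<lambda>r c. complex_of_real (\<Sigma> r c)) = toeplitz_of_symbol (2 * k) F"
    and range: "\<forall>B \<in> essential_range (2 * k) F. G_matrix k B"
  shows "stationary_G_chain k \<Sigma>" "bounded_on_l2 (2 * k) (\<lambda>r c. complex_of_real (\<Sigma> r c))"
    "partially_symmetric k \<Sigma>"
proof -
  define d where "d = 2 * k"
  have d: "0 < d" using k by (simp add: d_def)
  define G where "G t a b = F t $$ (a, b)" for t a b
  have carr: "F t \<in> carrier_mat d d" if "t \<in> {-pi..pi}" for t
    using F that by (simp add: L_inf_def d_def)
  have meas: "(\<lambda>t. G t a b) \<in> borel_measurable circ" if "a < d" "b < d" for a b
    using F that by (simp add: L_inf_def d_def G_def)
  have bdd: "\<exists>C. AE t in circ. cmod (G t a b) \<le> C" if "a < d" "b < d" for a b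
    using F that by (simp add: L_inf_def d_def G_def)
  then have int: "integrable circ (\<lambda>t. G t a b)" if "a < d" "b < d" for a b
    using that integrable_if_AE_bounded[OF meas] by blast
  have S': "complex_of_real (\<Sigma> r c) = toep d (fcoef G) r c" for r c
    using fun_cong[OF fun_cong[OF S], of r c] d by (simp add: toeplitz_of_symbol_eq_toep G_def[abs_def] d_def)
  have "AE t in circ. F t \<in> essential_range d F"
    by (rule AE_in_essential_range[OF carr meas[unfolded G_def]])
  then have AE_G: "AE t in circ. G_matrix k (F t)"
    by eventually_elim (use range in \<open>simp add: d_def\<close>)
  then have real: "AE t in circ. \<forall>a<d. \<forall>b<d. G t a b \<in> \<real>"
    by eventually_elim (simp add: G_matrix_iff G_def d_def)
  \<comment> \<open>The shape with \<open>1 * G t a b\<close> is that of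
    \<open>fcoef_affine\<close>, which later moves the constant into the coefficient of index
    0.\<close>
  from AE_G have psd: "AE t in circ. psd d (\<lambda>a b. \<i> / 2 * J_entry a b + 1 * G t a b)"
    by eventually_elim (simp add: G_matrix_iff G_def d_def add.commute)
  have herm: "AE t in circ. \<forall>a<d. \<forall>b<d. G t b a = cnj (G t a b)"
    using psd
  proof eventually_elim
    case (elim t)
    show ?case
    proof (intro allI impI)
      fix a b assume "a < d" "b < d"
      \<comment> \<open>Since J is real and antisymmetric, \<open>\<i> / 2\<close> times J is itself
        Hermitian and cancels.\<close>
      from psd_hermitian[OF elim this] show "G t b a = cnj (G t a b)"
        using J_entry_antisym[of b a] by simp
    qed
  qed
  have "\<exists>C. AE t in circ. \<forall>a<d. \<forall>b<d. cmod (G t a b) \<le> C"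
  proof -
    obtain C where C: "\<And>a b. a < d \<Longrightarrow> b < d \<Longrightarrow> AE t in circ. cmod (G t a b) \<le> C a b"
      using bdd by metis
    let ?C = "\<Sum>a<d. \<Sum>b<d. \<bar>C a b\<bar>"
    have le: "C a b \<le> ?C" if "a < d" "b < d" for a b
    proof -
      have "C a b \<le> \<bar>C a b\<bar>" by simp
      also have "\<dots> \<le> (\<Sum>b<d. \<bar>C a b\<bar>)"
        using that by (intro member_le_sum) auto
      also have "\<dots> \<le> ?C"
        using that by (intro member_le_sum[of a _ "\<lambda>a. \<Sum>b<d. \<bar>C a b\<bar>"]) (auto intro: sum_nonneg)
      finally show ?thesis .
    qed
    have "AE t in circ. \<forall>a\<in>{..<d}. \<forall>b\<in>{..<d}. cmod (G t a b) \<le> ?C"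
    proof (intro AE_finite_allI)
      fix a b assume ab: "a \<in> {..<d}" "b \<in> {..<d}"
      then have "AE t in circ. cmod (G t a b) \<le> C a b" using C by simp
      then show "AE t in circ. cmod (G t a b) \<le> ?C"
        by eventually_elim (use le[of a b] ab in simp)
    qed auto
    then have "AE t in circ. \<forall>a<d. \<forall>b<d. cmod (G t a b) \<le> ?C"
      by eventually_elim auto
    then show ?thesis ..
  qed
  then obtain C where bound: "AE t in circ. \<forall>a<d. \<forall>b<d. cmod (G t a b) \<le> C" ..
  obtain K where "section_bound d (toep d (fcoef G)) K"
    using section_bound_symbol[OF d meas bound herm] by blast
  from section_bound_imp_bounded_on_l2[OF this d]
  show "bounded_on_l2 (2 * k) (\<lambda>r c. complex_of_real (\<Sigma> r c))"
    by (simp add: S' d_def)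
  define R where "R n = mat d d (\<lambda>(a, b). Re (fcoef G n a b))" for n
  have R_carr: "R n \<in> carrier_mat d d" for n by (simp add: R_def)
  have coef_real: "cnj (fcoef G n a b) = fcoef G n a b" if ab: "a < d" "b < d" for n a b
  proof -
    \<comment> \<open>Every coefficient occurs in the matrix, also for negative n: one of
      \<open>nat n\<close> and \<open>nat (- n)\<close> is 0, and their difference is n. So realness
      of \<Sigma> makes all coefficients real.\<close>
    have "fcoef G n a b = of_real (\<Sigma> (d * nat n + a) (d * nat (- n) + b))"
      unfolding S' toep_block[OF ab] by simp
    then show ?thesis by (simp only: complex_cnj_complex_of_real)
  qed
  have R_sym: "R (- n) = R n" for n
  proof (rule eq_matI)
    fix a b assume "a < dim_row (R n)" "b < dim_col (R n)"
    then have ab: "a < d" "b < d" by (simp_all add: R_def)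
    have "AE t in circ. G t a b \<in> \<real>"
      using real by eventually_elim (use ab in simp)
    \<comment> \<open>The real part in the definition of \<open>R\<close> absorbs the
      conjugation.\<close>
    from fcoef_uminus[of G a b n, OF this meas[OF ab]] show "R (- n) $$ (a, b) = R n $$ (a, b)"
      using ab by (simp add: R_def)
  qed (simp_all add: R_def)
  have SR: "\<Sigma> = block_toeplitz d R"
  proof (intro ext)
    fix r c
    have "of_real (\<Sigma> r c) = complex_of_real (block_toeplitz d R r c)"
      using d coef_real[of "r mod d" "c mod d"] unfolding S' block_toeplitz_def toep_def R_def
      by (simp add: complex_eq_iff)
    then show "\<Sigma> r c = block_toeplitz d R r c" by (simp only: of_real_eq_iff)
  qed
  show "partially_symmetric k \<Sigma>"
    unfolding partially_symmetric_def d_def[symmetric] using R_carr R_sym SR by blast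
  have "psd (d * n) (\<lambda>r c. of_real (\<Sigma> r c) + \<i> / 2 * J_entry r c)" for n
  proof -
    have "psd (d * n) (toep d (fcoef (\<lambda>t a b. \<i> / 2 * J_entry a b + 1 * G t a b)))"
    proof (rule psd_toep_fcoef[OF _ psd])
      interpret finite_measure circ by (rule finite_measure_circ)
      show "integrable circ (\<lambda>t. \<i> / 2 * J_entry a b + 1 * G t a b)" if "a < d" "b < d" for a b
        by (intro Bochner_Integration.integrable_add integrable_mult_right int that) auto
    qed
    also have "?this \<longleftrightarrow> psd (d * n) (toep d (\<lambda>n a b. fcoef G n a b + (if n = 0 then \<i> / 2 * J_entry a b else 0)))"
      unfolding toep_def by (rule psd_cong, subst fcoef_affine[OF int]) (use d in auto)
    also have "\<dots> \<longleftrightarrow> psd (d * n) (\<lambda>r c. of_real (\<Sigma> r c) + \<i> / 2 * J_entry r c)"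
      unfolding d_def toep_add_J[OF k] unfolding d_def[symmetric] S' ..
    finally show ?thesis .
  qed
  then show "stationary_G_chain k \<Sigma>"
    unfolding stationary_G_chain_def G_matrix_truncation_iff unfolding d_def[symmetric]
    using R_carr SR by blast
qed

theorem theorem2p5:
  fixes k :: nat and \<Sigma> :: "nat \<Rightarrow> nat \<Rightarrow> real"
  assumes "k \<ge> 1"
  shows "(stationary_G_chain k \<Sigma> \<and>
          bounded_on_l2 (2 * k) (\<lambda>r c. complex_of_real (\<Sigma> r c)) \<and>
          partially_symmetric k \<Sigma>)
     \<longleftrightarrow> (\<exists>F \<in> L_inf (2 * k).
            (\<lambda>r c. complex_of_real (\<Sigma> r c)) = toeplitz_of_symbol (2 * k) F \<and>
            (\<forall>B \<in> essential_range (2 * k) F. G_matrix k B))"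
proof
  have k: "0 < k" using assms by simp
  show "stationary_G_chain k \<Sigma> \<and> bounded_on_l2 (2 * k) (\<lambda>r c. complex_of_real (\<Sigma> r c)) \<and>
      partially_symmetric k \<Sigma> \<Longrightarrow>
    \<exists>F \<in> L_inf (2 * k). (\<lambda>r c. complex_of_real (\<Sigma> r c)) = toeplitz_of_symbol (2 * k) F \<and>
      (\<forall>B \<in> essential_range (2 * k) F. G_matrix k B)"
    using symbol_of_chain[OF k] by blast
  show "\<exists>F \<in> L_inf (2 * k). (\<lambda>r c. complex_of_real (\<Sigma> r c)) = toeplitz_of_symbol (2 * k) F \<and>
      (\<forall>B \<in> essential_range (2 * k) F. G_matrix k B) \<Longrightarrow>
    stationary_G_chain k \<Sigma> \<and> bounded_on_l2 (2 * k) (\<lambda>r c. complex_of_real (\<Sigma> r c)) \<and>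
      partially_symmetric k \<Sigma>"
    using chain_of_symbol[OF k] by blast
qed

end
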